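(* Let $(T(t))_{t\ge 0}$ be a bounded $C_0$-semigroup on a Hilbert space $X$, with generator $-A$. Assume that $\sigma(A)\cap i\mathbb{R}$ is empty, and fix $\alpha>0$ and $\beta\ge 0$. (a) The following statements are equivalent: (i) $\|(is+A)^{-1}\| = O\left(|s|^{\alpha}(\log|s|)^{-\beta}\right)$ as $|s|\to\infty$ ($s\in\mathbb{R}$); (ii) $\|T(t)A^{-1}\| = O\left(t^{-1/\alpha}(\log t)^{-\beta/\alpha}\right)$ as $t\to\infty$. (b) If $\|(is+A)^{-1}\| = O\left(|s|^{\alpha}(\log|s|)^{\beta}\right)$ as $|s|\to\infty$, then, for every $\varepsilon>0$, $$\|T(t)A^{-1}\| = O\left(t^{-1/\alpha}(\log t)^{\varepsilon+\beta/\alpha}\right),\qquad t\to\infty.$$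
   Context: The generator of the semigroup is denoted by $-A$ (not $A$); $\sigma(A)$ is the spectrum of $A$. Since $\sigma(A)\cap i\mathbb{R}=\emptyset$, the operator $A$ is invertible with $A^{-1}$ bounded, and $is+A$ is invertible for all real $s$. Spaces are complex. *)

theory Defs
  imports "HOL-Analysis.Analysis" "HOL-Library.Landau_Symbols"
begin

section \<open>Complex Hilbert spaces\<close>

class complex_vector = real_vector +
  fixes scaleC :: "complex \<Rightarrow> 'a \<Rightarrow> 'a"  (infixr \<open>*\<^sub>C\<close> 75)
  assumes scaleC_add_right: "a *\<^sub>C (x + y) = a *\<^sub>C x + a *\<^sub>C y"
    and scaleC_add_left: "(a + b) *\<^sub>C x = a *\<^sub>C x + b *\<^sub>C x"
    and scaleC_scaleC: "a *\<^sub>C b *\<^sub>C x = (a * b) *\<^sub>C x"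
    and scaleC_of_real: "complex_of_real r *\<^sub>C x = r *\<^sub>R x"

text \<open>
  Every complex inner product space is a real one for the real part of its inner product, with
  the same norm. Building on \<^class>\<open>real_inner\<close> therefore costs no generality, and positive
  definiteness of the complex inner product (linear in its first argument) and its relation to
  the norm are inherited from there.
\<close>

class complex_inner = complex_vector + real_inner +
  fixes cinner :: "'a \<Rightarrow> 'a \<Rightarrow> complex"
  assumes cinner_commute: "cinner x y = cnj (cinner y x)"
    and cinner_add_left: "cinner (x + y) z = cinner x z + cinner y z"
    and cinner_scaleC_left: "cinner (a *\<^sub>C x) y = a * cinner x y"
    and Re_cinner: "Re (cinner x y) = inner x y"

class chilbert_space = complex_inner + complete_space

lemma cinner_self_eq_norm:
  fixes x :: "'a::complex_inner"
  shows "cinner x x = complex_of_real ((norm x)\<^sup>2)"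
proof (rule complex_eqI)
  have "Im (cinner x x) = Im (cnj (cinner x x))"
    using cinner_commute[of x x] by simp
  then show "Im (cinner x x) = Im (complex_of_real ((norm x)\<^sup>2))"
    by simp
qed (simp add: Re_cinner power2_norm_eq_inner)

instantiation complex :: chilbert_space
begin

definition scaleC_complex :: "complex \<Rightarrow> complex \<Rightarrow> complex"
  where "scaleC_complex a x = a * x"

definition cinner_complex :: "complex \<Rightarrow> complex \<Rightarrow> complex"
  where "cinner_complex x y = x * cnj y"

instance
  by standard
    (simp_all add: scaleC_complex_def cinner_complex_def algebra_simps scaleR_conv_of_real
      inner_complex_def)

end

section \<open>Operators and spectrum\<close>

definition bounded_clinear :: "('a::complex_inner \<Rightarrow> 'b::complex_inner) \<Rightarrow> bool"
  where "bounded_clinear f \<longleftrightarrow> bounded_linear f \<and> (\<forall>c x. f (c *\<^sub>C x) = c *\<^sub>C f x)"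

text \<open>
  An unbounded operator is given by its domain \<open>D\<close> and a function \<open>A\<close>, whose values outside \<open>D\<close>
  are irrelevant.
\<close>

definition resolvent_set :: "'a::complex_inner set \<Rightarrow> ('a \<Rightarrow> 'a) \<Rightarrow> complex set"
  where "resolvent_set D A =
    {z. bij_betw (\<lambda>x. z *\<^sub>C x - A x) D UNIV \<and>
        bounded_clinear (inv_into D (\<lambda>x. z *\<^sub>C x - A x))}"

definition spectrum :: "'a::complex_inner set \<Rightarrow> ('a \<Rightarrow> 'a) \<Rightarrow> complex set"
  where "spectrum D A = - resolvent_set D A"

section \<open>Operator semigroups\<close>

text \<open>Families are indexed by \<^typ>\<open>real\<close>; only the values at \<open>t \<ge> 0\<close> matter.\<close>

definition C0_semigroup :: "(real \<Rightarrow> 'a::complex_inner \<Rightarrow> 'a) \<Rightarrow> bool"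
  where "C0_semigroup T \<longleftrightarrow>
    (\<forall>t\<ge>0. bounded_clinear (T t)) \<and>
    (\<forall>x. T 0 x = x) \<and>
    (\<forall>s\<ge>0. \<forall>t\<ge>0. \<forall>x. T (s + t) x = T s (T t x)) \<and>
    (\<forall>x. ((\<lambda>t. T t x) \<longlongrightarrow> x) (at_right 0))"

definition bounded_C0_semigroup :: "(real \<Rightarrow> 'a::complex_inner \<Rightarrow> 'a) \<Rightarrow> bool"
  where "bounded_C0_semigroup T \<longleftrightarrow>
    C0_semigroup T \<and> (\<exists>M. \<forall>t\<ge>0. onorm (T t) \<le> M)"

definition is_generator ::
    "(real \<Rightarrow> 'a::complex_inner \<Rightarrow> 'a) \<Rightarrow> 'a set \<Rightarrow> ('a \<Rightarrow> 'a) \<Rightarrow> bool"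
  where "is_generator T D G \<longleftrightarrow>
    D = {x. \<exists>y. ((\<lambda>t. (T t x - x) /\<^sub>R t) \<longlongrightarrow> y) (at_right 0)} \<and>
    (\<forall>x\<in>D. ((\<lambda>t. (T t x - x) /\<^sub>R t) \<longlongrightarrow> G x) (at_right 0))"

end

theory Submission
  imports
    Defs
    "HOL-Probability.Characteristic_Functions"
    "HOL-Computational_Algebra.Polynomial"
    "HOL-Real_Asymp.Real_Asymp"
begin

text \<open>
  Write \<open>R\<^sub>s = (\<i>s + A)\<inverse>\<close> and \<open>K = sup \<parallel>T(t)\<parallel>\<close>. Orbits and resolvents are linked by Fourier integrals
  \<open>F(s) = \<integral>\<^sub>0\<^sup>N e\<^sup>-\<^sup>i\<^sup>s\<^sup>t f(t) dt\<close> over a finite time interval and by integration by parts in them.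

  Resolvent growth implies decay because of Plancherel's identity, which holds in a Hilbert
  space. Let \<open>\<eta>\<close> be the window \<open>(x(1 - x))\<^sup>n\<close> with \<open>x = t/N\<close>, and let \<open>f(t) = \<eta>(t) T(t) A\<inverse> x\<close>. Integrating
  by parts \<open>n\<close> times gives \<open>F(s) = R\<^sub>s\<^sup>n A\<inverse> G(s)\<close>, where \<open>G\<close> is the transform of \<open>\<eta>\<^sup>(\<^sup>n\<^sup>)(t) T(t) x\<close>, a function
  of size \<open>N\<^sup>-\<^sup>n \<parallel>x\<parallel>\<close>. By the resolvent identity the multiplier is of size \<open>\<parallel>R\<^sub>s\<parallel>\<^sup>n / (1 + \<bar>s\<bar>)\<close>. If squares of
  transforms are integrated against a Gaussian of width \<open>R\<close>, then frequencies far beyond \<open>R\<close> do not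
  count, and on the time side functions are smoothed at scale \<open>1/R\<close>. As \<open>f\<close> has a Lipschitz constant
  of order \<open>\<parallel>x\<parallel>\<close>, that changes it by \<open>O(\<parallel>x\<parallel>/R)\<close> only (\<open>fourier_comparison\<close>). The result is
  \<open>\<parallel>T(N) A\<inverse>\<parallel> \<le> C (\<kappa> / N\<^sup>n + 1/R)\<close>, where \<open>\<kappa>\<close> bounds the multiplier up to frequencies of order \<open>R\<close>
  (\<open>decay_estimate\<close>). For \<open>\<parallel>R\<^sub>s\<parallel> = O(M(\<bar>s\<bar>))\<close> with \<open>M(s) = s\<^sup>\<alpha> (ln s)\<^sup>\<gamma>\<close> and \<open>n > 1/\<alpha>\<close>, the function
  \<open>M(s)\<^sup>n / s\<close> is essentially increasing, so \<open>\<kappa> = O(M(R)\<^sup>n / R)\<close>. Choosing \<open>R\<close> with \<open>M(R) \<approx> N\<close> yields the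
  rate \<open>1/R \<approx> N\<^sup>-\<^sup>1\<^sup>/\<^sup>\<alpha> (ln N)\<^sup>\<gamma>\<^sup>/\<^sup>\<alpha>\<close> (\<open>resolvent_growth_imp_decay\<close>). The exponent \<open>\<gamma>\<close> may have either sign:
  \<open>\<gamma> = -\<beta>\<close> is the implication from (i) to (ii), and \<open>\<gamma> = \<beta>\<close> implies (b).

  Conversely, integrating the derivative of \<open>e\<^sup>-\<^sup>i\<^sup>s\<^sup>t T(t)z\<close> gives \<open>\<parallel>z\<parallel> \<le> \<parallel>T(t)z\<parallel> + K t \<parallel>(\<i>s + A)z\<parallel>\<close>
  (\<open>norm_le_orbit\<close>). If \<open>\<parallel>T(t) A\<inverse>\<parallel> \<bar>s\<bar> \<le> 1/2\<close>, the first term on the right is absorbed by the left side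
  and \<open>\<parallel>R\<^sub>s\<parallel> = O(t)\<close> (\<open>decay_imp_resolvent_growth\<close>).
\<close>

section \<open>Complex scalars and inner products as bounded bilinear maps\<close>

instance chilbert_space \<subseteq> banach ..

lemma scaleC_zero_left [simp]: "0 *\<^sub>C x = (0::'a::complex_vector)"
  using scaleC_of_real[of 0 x] by simp

lemma scaleC_one [simp]: "1 *\<^sub>C x = (x::'a::complex_vector)"
  using scaleC_of_real[of 1 x] by simp

lemma scaleC_minus_left: "(- a) *\<^sub>C x = - (a *\<^sub>C (x::'a::complex_vector))"
  using scaleC_add_left[of "-a" a x] by (simp add: eq_neg_iff_add_eq_0)

lemma scaleC_diff_left: "(a - b) *\<^sub>C x = a *\<^sub>C x - b *\<^sub>C (x::'a::complex_vector)"
  using scaleC_add_left[of a "-b" x] by (simp add: scaleC_minus_left)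

lemma cinner_scaleC_right: "cinner x (a *\<^sub>C y) = cnj a * cinner x (y::'a::complex_inner)"
  by (metis cinner_commute cinner_scaleC_left complex_cnj_mult)

lemma norm_scaleC: "norm (a *\<^sub>C x) = cmod a * norm (x::'a::complex_inner)"
proof -
  have "complex_of_real ((norm (a *\<^sub>C x))\<^sup>2) = a * cnj a * complex_of_real ((norm x)\<^sup>2)"
    by (simp only: cinner_self_eq_norm[symmetric] cinner_scaleC_left cinner_scaleC_right mult_ac)
  also have "\<dots> = complex_of_real ((cmod a * norm x)\<^sup>2)"
    by (simp add: complex_norm_square[symmetric] power_mult_distrib)
  finally have "(norm (a *\<^sub>C x))\<^sup>2 = (cmod a * norm x)\<^sup>2"
    by (simp only: of_real_eq_iff)
  then show ?thesis
    by (simp add: power2_eq_iff_nonneg)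
qed

interpretation scaleC: bounded_bilinear "scaleC :: complex \<Rightarrow> 'a \<Rightarrow> 'a::complex_inner"
proof
  show "(a + a') *\<^sub>C b = a *\<^sub>C b + a' *\<^sub>C b" for a a' and b :: 'a
    by (rule scaleC_add_left)
  show "a *\<^sub>C (b + b') = a *\<^sub>C b + a *\<^sub>C b'" for a and b b' :: 'a
    by (rule scaleC_add_right)
  show "(r *\<^sub>R a) *\<^sub>C b = r *\<^sub>R a *\<^sub>C b" for r a and b :: 'a
    by (simp add: scaleC_scaleC scaleR_conv_of_real flip: scaleC_of_real[of r b] scaleC_of_real[of r "a *\<^sub>C b"])
  show "a *\<^sub>C r *\<^sub>R b = r *\<^sub>R a *\<^sub>C b" for r a and b :: 'a
    by (simp add: scaleC_scaleC mult.commute flip: scaleC_of_real[of r b] scaleC_of_real[of r "a *\<^sub>C b"])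
  show "\<exists>K. \<forall>a (b::'a). norm (a *\<^sub>C b) \<le> norm a * norm b * K"
    by (rule exI[of _ 1]) (simp add: norm_scaleC)
qed

lemma norm_cinner_le: "cmod (cinner x y) \<le> norm x * norm (y::'a::complex_inner)"
proof (cases "cinner x y = 0")
  case False
  define c where "c = cnj (sgn (cinner x y))"
  have c: "cmod c = 1"
    using False by (simp add: c_def norm_sgn)
  have "cinner (c *\<^sub>C x) y = complex_of_real (cmod (cinner x y))"
    using False
    by (simp add: cinner_scaleC_left c_def sgn_div_norm scaleR_conv_of_real complex_norm_square[symmetric]
        power2_eq_square mult.commute complex_cnj_mult field_simps)
  then have "cmod (cinner x y) = inner (c *\<^sub>C x) y"
    by (metis Re_cinner Re_complex_of_real)
  also have "\<dots> \<le> norm (c *\<^sub>C x) * norm y"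
    by (rule norm_cauchy_schwarz)
  finally show ?thesis
    by (simp add: norm_scaleC c)
qed simp

interpretation cinner: bounded_bilinear "cinner :: 'a \<Rightarrow> 'a::complex_inner \<Rightarrow> complex"
proof
  show "cinner (a + a') b = cinner a b + cinner a' b" for a a' b :: 'a
    by (rule cinner_add_left)
  show "cinner a (b + b') = cinner a b + cinner a b'" for a b b' :: 'a
    by (metis cinner_add_left cinner_commute complex_cnj_add)
  show "cinner (r *\<^sub>R a) b = r *\<^sub>R cinner a b" for r and a b :: 'a
    by (simp add: cinner_scaleC_left scaleR_conv_of_real flip: scaleC_of_real[of r a])
  show "cinner a (r *\<^sub>R b) = r *\<^sub>R cinner a b" for r and a b :: 'a
    by (simp add: cinner_scaleC_right scaleR_conv_of_real flip: scaleC_of_real[of r b])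
  show "\<exists>K. \<forall>a b :: 'a. norm (cinner a b) \<le> norm a * norm b * K"
    by (rule exI[of _ 1]) (simp add: norm_cinner_le)
qed

section \<open>A Gaussian Plancherel identity\<close>

lemma normal_density_cis:
  assumes "R > 0"
  shows "(\<integral>s. complex_of_real (normal_density 0 R s) * cis (- s * v) \<partial>lborel) = exp (- (R * v)\<^sup>2 / 2)"
proof -
  have "(\<integral>s. complex_of_real (normal_density 0 R s) * cis (- s * v) \<partial>lborel)
      = (\<integral>x. std_normal_density x *\<^sub>R iexp (- (R * v) * x) \<partial>lborel)"
    using assms
    by (subst lborel_integral_real_affine[where c = R and t = 0])
      (auto simp: normal_density_def cis_conv_exp scaleR_conv_of_real real_sqrt_mult power_mult_distrib
        integral_mult_right_zero[symmetric] field_simps simp del: integral_mult_right_zero intro!: Bochner_Integration.integral_cong)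
  also have "\<dots> = char std_normal_distribution (- (R * v))"
    unfolding char_def by (subst integral_density) auto
  finally show ?thesis
    by (simp add: char_std_normal_distribution exp_of_real)
qed

text \<open>
  Orbits of a bounded semigroup need not be integrable over the half-line, hence the finite interval;
  the windows used later are supported in it.
\<close>

definition fourier_on :: "real \<Rightarrow> (real \<Rightarrow> 'a) \<Rightarrow> real \<Rightarrow> 'a::chilbert_space"
  where "fourier_on N f s = integral {0..N} (\<lambda>t. cis (- s * t) *\<^sub>C f t)"

lemma continuous_on_cis_scaleC:
  assumes "continuous_on S (f :: real \<Rightarrow> 'a::complex_inner)"
  shows "continuous_on S (\<lambda>t. cis (- s * t) *\<^sub>C f t)"
  by (intro scaleC.continuous_on assms continuous_intros)

lemma norm_fourier_on_squared:
  fixes f :: "real \<Rightarrow> 'a::chilbert_space"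
  assumes f: "continuous_on {0..N} f"
  shows "complex_of_real ((norm (fourier_on N f s))\<^sup>2) =
    integral (cbox (0, 0) (N, N)) (\<lambda>(t, r). cis (- s * (t - r)) * cinner (f t) (f r))"
proof -
  let ?e = "\<lambda>t. cis (- s * t) *\<^sub>C f t"
  have e: "?e integrable_on {0..N}"
    by (intro integrable_continuous_real continuous_on_cis_scaleC f)
  have "complex_of_real ((norm (fourier_on N f s))\<^sup>2) = cinner (integral {0..N} ?e) (fourier_on N f s)"
    by (simp only: fourier_on_def cinner_self_eq_norm)
  also have "\<dots> = integral {0..N} (\<lambda>t. cinner (?e t) (fourier_on N f s))"
    using integral_linear[OF e cinner.bounded_linear_left] by (simp add: o_def)
  also have "\<dots> = integral {0..N} (\<lambda>t. integral {0..N} (\<lambda>r. cinner (?e t) (?e r)))"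
    unfolding fourier_on_def
    using integral_linear[OF e cinner.bounded_linear_right] by (simp add: o_def)
  also have "\<dots> = integral {0..N} (\<lambda>t. integral {0..N} (\<lambda>r. cis (- s * (t - r)) * cinner (f t) (f r)))"
  proof -
    have "cinner (?e t) (?e r) = cis (- s * (t - r)) * cinner (f t) (f r)" for t r
      by (simp add: cinner_scaleC_left cinner_scaleC_right cis_cnj mult.assoc[symmetric] cis_mult
          algebra_simps)
    then show ?thesis by simp
  qed
  also have "\<dots> = integral (cbox (0, 0) (N, N)) (\<lambda>(t, r). cis (- s * (t - r)) * cinner (f t) (f r))"
    by (subst integral_prod_continuous)
      (auto simp: cbox_Pair_eq split_def cbox_interval
        intro!: continuous_intros cinner.continuous_on continuous_on_compose2[OF f])
  finally show ?thesis .
qed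

text \<open>
  A Gaussian weight makes the Plancherel identity elementary: expanding the square gives a double
  integral over \<open>[0,N]\<^sup>2\<close>, and by Fubini the integral over the frequency falls on the characters
  alone, where it is the characteristic function of a normal distribution. On the time side the
  weight thus becomes a smoothing kernel of width \<open>1/R\<close>.
\<close>

lemma gaussian_plancherel:
  fixes f :: "real \<Rightarrow> 'a::chilbert_space"
  assumes f: "continuous_on {0..N} f" and R: "R > 0"
  shows "integrable lborel (\<lambda>s. normal_density 0 R s * (norm (fourier_on N f s))\<^sup>2)"
    and "(\<integral>s. normal_density 0 R s * (norm (fourier_on N f s))\<^sup>2 \<partial>lborel) =
      integral (cbox (0, 0) (N, N)) (\<lambda>(t, r). exp (- (R * (t - r))\<^sup>2 / 2) * inner (f t) (f r))"
proof -
  let ?Q = "cbox (0, 0) (N, N) :: (real \<times> real) set"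
  define c where "c = (\<lambda>q. cinner (f (fst q)) (f (snd q)))"
  have c: "continuous_on ?Q c"
    unfolding c_def by (intro cinner.continuous_on continuous_on_compose2[OF f] continuous_intros)
      (auto simp: cbox_Pair_eq)
  then obtain B where B: "\<And>q. q \<in> ?Q \<Longrightarrow> cmod (c q) \<le> B"
    using compact_imp_bounded[OF compact_continuous_image[OF c compact_cbox]]
    by (auto simp: bounded_iff)
  \<comment> \<open>The integrand is only known to be continuous on the square, so it is cut off there before
    the Lebesgue theory on the whole plane is applied.\<close>
  define h where "h = (\<lambda>q. indicator ?Q q *\<^sub>R c q)"
  have h[measurable]: "h \<in> borel_measurable borel"
    unfolding h_def by (intro borel_measurable_continuous_on_indicator c) auto
  have hB: "cmod (h q) \<le> B * indicator ?Q q" for q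
    using B[of q] by (auto simp: h_def indicator_def)
  have hint: "integrable lborel h"
  proof (rule Bochner_Integration.integrable_bound)
    show "integrable lborel (\<lambda>q. B * indicator ?Q q)"
      by (intro integrable_mult_right integrable_real_indicator) (auto simp: emeasure_lborel_cbox_eq)
    show "AE q in lborel. cmod (h q) \<le> norm (B * indicator ?Q q)"
      using order_trans[OF hB abs_ge_self] by (intro AE_I2) simp
  qed simp
  define \<Phi> where "\<Phi> = (\<lambda>s q. complex_of_real (normal_density 0 R s) * cis (- s * (fst q - snd q)) * h q)"
  have \<Phi>: "integrable (lborel \<Otimes>\<^sub>M lborel) (case_prod \<Phi>)"
  proof (rule lborel_pair.Fubini_integrable)
    show "case_prod \<Phi> \<in> borel_measurable (lborel \<Otimes>\<^sub>M lborel)"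
    proof -
      have "(\<lambda>p::real \<times> real \<times> real. complex_of_real (normal_density 0 R (fst p)) * cis (- fst p * (fst (snd p) - snd (snd p))))
          \<in> borel_measurable borel"
        using R unfolding normal_density_def by (intro borel_measurable_continuous_onI continuous_intros) auto
      moreover have "(\<lambda>p::real \<times> real \<times> real. h (snd p)) \<in> borel_measurable borel"
        by (intro measurable_compose[OF borel_measurable_continuous_onI h] continuous_intros)
      ultimately show ?thesis
        unfolding lborel_prod \<Phi>_def split_def by measurable
    qed
    have "integrable lborel (\<lambda>s. normal_density 0 R s * (\<integral>q. cmod (h q) \<partial>lborel))"
      using R by (intro integrable_mult_left integrable_normal_density)
    then show "integrable lborel (\<lambda>s. \<integral>q. norm (case (s, q) of (s, q) \<Rightarrow> \<Phi> s q) \<partial>lborel)"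
      by (simp add: \<Phi>_def norm_mult)
    show "AE s in lborel. integrable lborel (\<lambda>q. case (s, q) of (s, q) \<Rightarrow> \<Phi> s q)"
    proof (intro AE_I2)
      fix s :: real
      have [measurable]: "(\<lambda>q::real \<times> real. cis (- (s * (fst q - snd q)))) \<in> borel_measurable borel"
        by (intro borel_measurable_continuous_onI continuous_intros)
      show "integrable lborel (\<lambda>q. case (s, q) of (s, q) \<Rightarrow> \<Phi> s q)"
        by (rule Bochner_Integration.integrable_bound[OF integrable_mult_right[OF integrable_norm[OF hint], of "normal_density 0 R s"]])
          (auto simp: \<Phi>_def norm_mult)
    qed
  qed
  have onQ: "(\<integral>q. k q * h q \<partial>lborel) = integral ?Q (\<lambda>q. k q * c q)"
    if k: "continuous_on UNIV k" for k :: "real \<times> real \<Rightarrow> complex"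
  proof -
    have "continuous_on ?Q (\<lambda>q. k q * c q)"
      by (intro continuous_intros c continuous_on_subset[OF k]) auto
    then have "set_integrable lborel ?Q (\<lambda>q. k q * c q)"
      unfolding set_integrable_def by (intro borel_integrable_compact) auto
    from set_borel_integral_eq_integral(2)[OF this] show ?thesis
      by (simp add: set_lebesgue_integral_def h_def mult.left_commute scaleR_conv_of_real)
  qed
  have 1: "(\<integral>q. \<Phi> s q \<partial>lborel) = complex_of_real (normal_density 0 R s * (norm (fourier_on N f s))\<^sup>2)" for s
  proof -
    have "(\<integral>q. \<Phi> s q \<partial>lborel) = complex_of_real (normal_density 0 R s) * (\<integral>q. cis (- s * (fst q - snd q)) * h q \<partial>lborel)"
      by (simp only: \<Phi>_def mult.assoc integral_mult_right_zero)
    also have "\<dots> = complex_of_real (normal_density 0 R s) * complex_of_real ((norm (fourier_on N f s))\<^sup>2)"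
      unfolding norm_fourier_on_squared[OF f]
      by (subst onQ) (auto intro!: continuous_intros simp: c_def split_def)
    finally show ?thesis by simp
  qed
  have 2: "(\<integral>s. \<Phi> s q \<partial>lborel) = exp (- (R * (fst q - snd q))\<^sup>2 / 2) * h q" for q
    using normal_density_cis[OF R, of "fst q - snd q"]
    by (simp only: \<Phi>_def integral_mult_left_zero)
  have int: "integrable lborel (\<lambda>s. complex_of_real (normal_density 0 R s * (norm (fourier_on N f s))\<^sup>2))"
    using lborel_pair.integrable_fst[OF \<Phi>] by (simp only: 1)
  then show "integrable lborel (\<lambda>s. normal_density 0 R s * (norm (fourier_on N f s))\<^sup>2)"
    by (simp only: complex_of_real_integrable_eq)
  have cont: "continuous_on ?Q (\<lambda>q. complex_of_real (exp (- (R * (fst q - snd q))\<^sup>2 / 2)) * c q)"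
    by (auto intro!: continuous_intros c)
  have "complex_of_real (\<integral>s. normal_density 0 R s * (norm (fourier_on N f s))\<^sup>2 \<partial>lborel)
      = (\<integral>s. (\<integral>q. \<Phi> s q \<partial>lborel) \<partial>lborel)"
    by (simp only: 1 integral_complex_of_real)
  also have "\<dots> = (\<integral>q. (\<integral>s. \<Phi> s q \<partial>lborel) \<partial>lborel)"
    by (rule lborel_pair.Fubini_integral[OF \<Phi>, symmetric])
  also have "\<dots> = integral ?Q (\<lambda>q. complex_of_real (exp (- (R * (fst q - snd q))\<^sup>2 / 2)) * c q)"
    unfolding 2 by (rule onQ) (auto intro!: continuous_intros)
  finally have "(\<integral>s. normal_density 0 R s * (norm (fourier_on N f s))\<^sup>2 \<partial>lborel)
      = Re (integral ?Q (\<lambda>q. complex_of_real (exp (- (R * (fst q - snd q))\<^sup>2 / 2)) * c q))"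
    by (metis Re_complex_of_real)
  also have "\<dots> = integral ?Q (\<lambda>q. Re (complex_of_real (exp (- (R * (fst q - snd q))\<^sup>2 / 2)) * c q))"
    using integral_linear[OF integrable_continuous[OF cont] bounded_linear_Re] by (simp add: o_def)
  finally show "(\<integral>s. normal_density 0 R s * (norm (fourier_on N f s))\<^sup>2 \<partial>lborel) =
      integral ?Q (\<lambda>(t, r). exp (- (R * (t - r))\<^sup>2 / 2) * inner (f t) (f r))"
    by (simp add: c_def split_def Re_cinner)
qed

section \<open>Energy of truncated Fourier transforms\<close>

text \<open>
  The constant is a convenient upper bound for \<open>sqrt (2\<pi>)\<close>.
\<close>

lemma gaussian_integral_le:
  fixes R N t :: real
  assumes "R > 0"
  shows "integral {0..N} (\<lambda>r. exp (- (R * (t - r))\<^sup>2 / 2)) \<le> 3 / R"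
proof -
  have eq: "exp (- (R * (t - r))\<^sup>2 / 2) = sqrt (2 * pi) / R * normal_density t (1 / R) r" for r
  proof -
    have "(R * (t - r))\<^sup>2 = R\<^sup>2 * (r - t)\<^sup>2"
      by (simp add: power_mult_distrib power2_commute)
    then show ?thesis
      using assms by (simp add: normal_density_def real_sqrt_divide real_sqrt_mult power_divide)
  qed
  have int: "integrable lborel (\<lambda>r. sqrt (2 * pi) / R * normal_density t (1 / R) r)"
    using assms by (intro integrable_mult_right integrable_normal_density) auto
  have si: "set_integrable lborel {0..N} (\<lambda>r. sqrt (2 * pi) / R * normal_density t (1 / R) r)"
    unfolding set_integrable_def by (intro integrable_mult_indicator int) auto
  have "integral {0..N} (\<lambda>r. exp (- (R * (t - r))\<^sup>2 / 2)) = (LINT r:{0..N}|lborel. sqrt (2 * pi) / R * normal_density t (1 / R) r)"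
    unfolding eq by (rule set_borel_integral_eq_integral(2)[OF si, symmetric])
  also have "\<dots> \<le> (\<integral>r. sqrt (2 * pi) / R * normal_density t (1 / R) r \<partial>lborel)"
    unfolding set_lebesgue_integral_def
    using assms by (intro integral_mono int si[unfolded set_integrable_def]) (auto simp: indicator_def)
  also have "\<dots> = sqrt (2 * pi) / R"
    using assms by simp
  also have "\<dots> \<le> 3 / R"
  proof -
    have "sqrt (2 * pi) \<le> sqrt 9"
      using pi_less_4 by (intro real_sqrt_le_mono) simp
    then show ?thesis using assms by (intro divide_right_mono) auto
  qed
  finally show ?thesis .
qed

text \<open>
  An interval of length \<open>1/R\<close> with end point \<open>t\<close>, to its left or to its right, stays inside \<open>[0,N]\<close>,
  and on it the kernel is at least \<open>exp (-1/2)\<close>.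
\<close>

lemma gaussian_integral_ge:
  fixes R N t :: real
  assumes "R > 0" "2 / R \<le> N" "t \<in> {0..N}"
  shows "1 / (2 * R) \<le> integral {0..N} (\<lambda>r. exp (- (R * (t - r))\<^sup>2 / 2))"
proof -
  define a where "a = (if t + 1 / R \<le> N then t else t - 1 / R)"
  have a: "{a..a + 1 / R} \<subseteq> {0..N}" "\<And>r. r \<in> {a..a + 1 / R} \<Longrightarrow> \<bar>t - r\<bar> \<le> 1 / R"
    using assms by (auto simp: a_def field_simps split: if_splits)
  have "1 / 2 \<le> exp (- 1 / 2 :: real)"
    using exp_ge_add_one_self[of "- 1 / 2 :: real"] by simp
  then have "1 / (2 * R) \<le> integral {a..a + 1 / R} (\<lambda>r. exp (- 1 / 2))"
    using assms by (simp add: field_simps)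
  also have "\<dots> \<le> integral {a..a + 1 / R} (\<lambda>r. exp (- (R * (t - r))\<^sup>2 / 2))"
  proof (rule integral_le)
    fix r assume "r \<in> {a..a + 1 / R}"
    then have "\<bar>R * (t - r)\<bar> \<le> 1"
      using mult_left_mono[OF a(2)[of r], of R] assms by (simp add: abs_mult)
    then have "(R * (t - r))\<^sup>2 \<le> 1"
      by (simp add: abs_square_le_1)
    then show "exp (- 1 / 2) \<le> exp (- (R * (t - r))\<^sup>2 / 2)"
      by simp
  qed (auto intro!: integrable_continuous_real continuous_intros)
  also have "\<dots> \<le> integral {0..N} (\<lambda>r. exp (- (R * (t - r))\<^sup>2 / 2))"
    by (intro integral_subset_le a) (auto intro!: integrable_continuous_real continuous_intros)
  finally show ?thesis .
qed

lemma gaussian_energy_iterated: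
  fixes f :: "real \<Rightarrow> 'a::chilbert_space"
  assumes f: "continuous_on {0..N} f" and R: "R > 0"
  shows "(\<integral>s. normal_density 0 R s * (norm (fourier_on N f s))\<^sup>2 \<partial>lborel) =
      integral {0..N} (\<lambda>t. integral {0..N} (\<lambda>r. exp (- (R * (t - r))\<^sup>2 / 2) * inner (f t) (f r)))"
    and "(\<lambda>t. integral {0..N} (\<lambda>r. exp (- (R * (t - r))\<^sup>2 / 2) * inner (f t) (f r))) integrable_on {0..N}"
    and "\<And>t. t \<in> {0..N} \<Longrightarrow> (\<lambda>r. exp (- (R * (t - r))\<^sup>2 / 2) * inner (f t) (f r)) integrable_on {0..N}"
proof -
  have cont: "continuous_on ({0..N} \<times> {0..N}) (\<lambda>(t, r). exp (- (R * (t - r))\<^sup>2 / 2) * inner (f t) (f r))"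
    unfolding split_def
    by (auto intro!: continuous_intros continuous_on_compose2[OF f])
  show "(\<integral>s. normal_density 0 R s * (norm (fourier_on N f s))\<^sup>2 \<partial>lborel) =
      integral {0..N} (\<lambda>t. integral {0..N} (\<lambda>r. exp (- (R * (t - r))\<^sup>2 / 2) * inner (f t) (f r)))"
    using gaussian_plancherel(2)[OF f R] cont
    by (subst (asm) integral_prod_continuous) (auto simp: cbox_Pair_eq)
  show "(\<lambda>t. integral {0..N} (\<lambda>r. exp (- (R * (t - r))\<^sup>2 / 2) * inner (f t) (f r))) integrable_on {0..N}"
    using integral_continuous_on_param[of "{0..N}" 0 N "\<lambda>t r. exp (- (R * (t - r))\<^sup>2 / 2) * inner (f t) (f r)"] cont
    by (intro integrable_continuous_real) simp
  show "(\<lambda>r. exp (- (R * (t - r))\<^sup>2 / 2) * inner (f t) (f r)) integrable_on {0..N}" for t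
    by (intro integrable_continuous_real) (auto intro!: continuous_intros f)
qed

lemma gaussian_energy_le:
  fixes f :: "real \<Rightarrow> 'a::chilbert_space"
  assumes f: "continuous_on {0..N} f" and R: "R > 0" and N: "N \<ge> 0"
    and B: "\<And>t. t \<in> {0..N} \<Longrightarrow> norm (f t) \<le> B"
  shows "(\<integral>s. normal_density 0 R s * (norm (fourier_on N f s))\<^sup>2 \<partial>lborel) \<le> 3 * B\<^sup>2 * N / R"
proof -
  have "integral {0..N} (\<lambda>t. integral {0..N} (\<lambda>r. exp (- (R * (t - r))\<^sup>2 / 2) * inner (f t) (f r)))
      \<le> integral {0..N} (\<lambda>t. B\<^sup>2 * (3 / R))"
  proof (rule integral_le)
    fix t assume t: "t \<in> {0..N}"
    have "integral {0..N} (\<lambda>r. exp (- (R * (t - r))\<^sup>2 / 2) * inner (f t) (f r))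
        \<le> integral {0..N} (\<lambda>r. B\<^sup>2 * exp (- (R * (t - r))\<^sup>2 / 2))"
    proof (rule integral_le)
      fix r assume r: "r \<in> {0..N}"
      have "inner (f t) (f r) \<le> B * B"
        using norm_cauchy_schwarz[of "f t" "f r"] mult_mono[OF B[OF t] B[OF r]] B[OF t] norm_ge_zero[of "f t"]
        by (meson norm_ge_zero order_trans)
      then show "exp (- (R * (t - r))\<^sup>2 / 2) * inner (f t) (f r) \<le> B\<^sup>2 * exp (- (R * (t - r))\<^sup>2 / 2)"
        by (simp add: power2_eq_square mult.commute)
    qed (use gaussian_energy_iterated(3)[OF f R t] in \<open>auto intro!: integrable_continuous_real continuous_intros\<close>)
    also have "\<dots> = B\<^sup>2 * integral {0..N} (\<lambda>r. exp (- (R * (t - r))\<^sup>2 / 2))"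
      by simp
    also have "\<dots> \<le> B\<^sup>2 * (3 / R)"
      by (intro mult_left_mono gaussian_integral_le R) auto
    finally show "integral {0..N} (\<lambda>r. exp (- (R * (t - r))\<^sup>2 / 2) * inner (f t) (f r)) \<le> B\<^sup>2 * (3 / R)" .
  qed (use gaussian_energy_iterated(2)[OF f R] in auto)
  then show ?thesis
    unfolding gaussian_energy_iterated(1)[OF f R] using N by (simp add: mult_ac)
qed

text \<open>
  Up to a constant, the lower bound is what Plancherel would give without a weight. Smoothing at
  scale \<open>1/R\<close> moves a function with Lipschitz constant \<open>L\<close> by about \<open>L/R\<close> only; the error term
  records this.
\<close>

lemma gaussian_energy_ge:
  fixes f :: "real \<Rightarrow> 'a::chilbert_space"
  assumes f: "continuous_on {0..N} f" and R: "R > 0" and N: "2 / R \<le> N"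
    and L: "\<And>t r. t \<in> {0..N} \<Longrightarrow> r \<in> {0..N} \<Longrightarrow> norm (f t - f r) \<le> L * \<bar>t - r\<bar>"
    and m: "\<And>t. t \<in> {N / 4..3 * N / 4} \<Longrightarrow> m \<le> norm (f t)" and m0: "m \<ge> 0"
  shows "N / (8 * R) * (m\<^sup>2 - 96 * L\<^sup>2 / R\<^sup>2)
    \<le> (\<integral>s. normal_density 0 R s * (norm (fourier_on N f s))\<^sup>2 \<partial>lborel)"
proof -
  let ?g = "\<lambda>t r. exp (- (R * (t - r))\<^sup>2 / 2)"
  define R' where "R' = R / sqrt 2"
  have R': "R' > 0" "3 / R' \<le> 6 / R"
    using R sqrt2_less_2 by (auto simp: R'_def field_simps)
  let ?h = "\<lambda>t r. exp (- (R' * (t - r))\<^sup>2 / 2)"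
  have N0: "N > 0"
    using N R by (smt (verit) divide_pos_pos)
  have gh: "?g t r * (t - r)\<^sup>2 \<le> 4 / R\<^sup>2 * ?h t r" for t r
  proof -
    define z where "z = (R * (t - r))\<^sup>2 / 4"
    \<comment> \<open>Half of the exponent absorbs the factor \<open>(t - r)\<^sup>2\<close>, leaving a kernel wider by \<open>sqrt 2\<close>.\<close>
    have "z \<le> exp z"
      using exp_ge_add_one_self[of z] by linarith
    then have "exp (- 2 * z) * (4 * z) \<le> exp (- 2 * z) * (4 * exp z)"
      by (intro mult_left_mono) auto
    also have "\<dots> = 4 * exp (- z)"
      by (simp flip: exp_add)
    finally have "R\<^sup>2 * (?g t r * (t - r)\<^sup>2) \<le> 4 * ?h t r"
      by (simp add: z_def R'_def power_mult_distrib power_divide mult_ac)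
    then show ?thesis
      using R by (simp add: pos_le_divide_eq mult.commute)
  qed
  have lower: "(norm (f t))\<^sup>2 / (4 * R) - 12 * L\<^sup>2 / R ^ 3 \<le> integral {0..N} (\<lambda>r. ?g t r * inner (f t) (f r))"
    if t: "t \<in> {0..N}" for t
  proof -
    have "(norm (f t))\<^sup>2 / (4 * R) - 12 * L\<^sup>2 / R ^ 3 = (norm (f t))\<^sup>2 / 2 * (1 / (2 * R)) - 2 * L\<^sup>2 / R\<^sup>2 * (6 / R)"
      by (simp add: power2_eq_square power3_eq_cube)
    also have "\<dots> \<le> (norm (f t))\<^sup>2 / 2 * integral {0..N} (?g t) - 2 * L\<^sup>2 / R\<^sup>2 * integral {0..N} (?h t)"
      using gaussian_integral_ge[OF R N t] order_trans[OF gaussian_integral_le[OF R'(1)] R'(2)]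
      by (intro diff_mono mult_left_mono) auto
    also have "\<dots> = integral {0..N} (\<lambda>r. (norm (f t))\<^sup>2 / 2 * ?g t r - 2 * L\<^sup>2 / R\<^sup>2 * ?h t r)"
      using R by (subst Henstock_Kurzweil_Integration.integral_diff) (auto intro!: integrable_continuous_real continuous_intros)
    also have "\<dots> \<le> integral {0..N} (\<lambda>r. ?g t r * inner (f t) (f r))"
    proof (rule integral_le)
      fix r assume r: "r \<in> {0..N}"
      have "(norm (f t - f r))\<^sup>2 \<le> L\<^sup>2 * (t - r)\<^sup>2"
        using power_mono[OF L[OF t r], of 2] by (simp add: power_mult_distrib)
      moreover have "inner (f t) (f r) = ((norm (f t))\<^sup>2 + (norm (f r))\<^sup>2 - (norm (f t - f r))\<^sup>2) / 2"
        by (simp add: power2_norm_eq_inner inner_diff_left inner_diff_right inner_commute)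
      moreover have "a / 2 - c / 2 * d \<le> (a + b - e) / 2" if "e \<le> c * d" "0 \<le> b" for a b c d e :: real
        using that by (simp add: field_simps)
      ultimately have "(norm (f t))\<^sup>2 / 2 - L\<^sup>2 / 2 * (t - r)\<^sup>2 \<le> inner (f t) (f r)"
        by (metis zero_le_power2)
      then have "?g t r * ((norm (f t))\<^sup>2 / 2 - L\<^sup>2 / 2 * (t - r)\<^sup>2) \<le> ?g t r * inner (f t) (f r)"
        by (intro mult_left_mono) auto
      moreover have "L\<^sup>2 / 2 * (?g t r * (t - r)\<^sup>2) \<le> L\<^sup>2 / 2 * (4 / R\<^sup>2 * ?h t r)"
        by (intro mult_left_mono gh) auto
      ultimately show "(norm (f t))\<^sup>2 / 2 * ?g t r - 2 * L\<^sup>2 / R\<^sup>2 * ?h t r \<le> ?g t r * inner (f t) (f r)"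
        by (simp add: algebra_simps)
    qed (use gaussian_energy_iterated(3)[OF f R t] R in \<open>auto intro!: integrable_continuous_real continuous_intros\<close>)
    finally show ?thesis .
  qed
  have sq: "(\<lambda>t. (norm (f t))\<^sup>2) integrable_on {0..N}"
    by (intro integrable_continuous_real continuous_intros f)
  have "N / 2 * m\<^sup>2 = integral {N / 4..3 * N / 4} (\<lambda>t. m\<^sup>2)"
    using N0 by (simp add: field_simps)
  also have "\<dots> \<le> integral {N / 4..3 * N / 4} (\<lambda>t. (norm (f t))\<^sup>2)"
    by (rule integral_le)
      (use m m0 N0 in \<open>auto intro!: integrable_continuous_real continuous_intros continuous_on_subset[OF f] power_mono\<close>)
  also have "\<dots> \<le> integral {0..N} (\<lambda>t. (norm (f t))\<^sup>2)"
    using N0 by (intro integral_subset_le sq integrable_on_subinterval[OF sq]) auto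
  finally have "N / (8 * R) * (m\<^sup>2 - 96 * L\<^sup>2 / R\<^sup>2)
      \<le> integral {0..N} (\<lambda>t. (norm (f t))\<^sup>2) / (4 * R) - N * (12 * L\<^sup>2 / R ^ 3)"
    using R by (simp add: field_simps power2_eq_square power3_eq_cube)
  also have "\<dots> = integral {0..N} (\<lambda>t. (norm (f t))\<^sup>2 / (4 * R) - 12 * L\<^sup>2 / R ^ 3)"
    using N0 sq R by (subst Henstock_Kurzweil_Integration.integral_diff)
      (auto intro!: integrable_continuous_real continuous_intros f)
  also have "\<dots> \<le> integral {0..N} (\<lambda>t. integral {0..N} (\<lambda>r. ?g t r * inner (f t) (f r)))"
    using R by (intro integral_le gaussian_energy_iterated(2)[OF f R] lower)
      (auto intro!: integrable_continuous_real continuous_intros f)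
  finally show ?thesis
    unfolding gaussian_energy_iterated(1)[OF f R] .
qed

text \<open>
  This is the way in which a pointwise domination of transforms becomes a domination in time. The
  domination need not be uniform in the frequency: it may be lost beyond \<open>\<bar>s\<bar> \<approx> R\<close> at a Gaussian
  rate, because part of the Gaussian weight can be spent on it.
\<close>

lemma fourier_comparison:
  fixes f g :: "real \<Rightarrow> 'a::chilbert_space"
  assumes f: "continuous_on {0..N} f" and g: "continuous_on {0..N} g" and R: "R > 0" and N: "2 / R \<le> N"
    and L: "\<And>t r. t \<in> {0..N} \<Longrightarrow> r \<in> {0..N} \<Longrightarrow> norm (f t - f r) \<le> L * \<bar>t - r\<bar>"
    and m: "\<And>t. t \<in> {N / 4..3 * N / 4} \<Longrightarrow> m \<le> norm (f t)" and m0: "m \<ge> 0"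
    and B: "\<And>t. t \<in> {0..N} \<Longrightarrow> norm (g t) \<le> B"
    and FG: "\<And>s. norm (fourier_on N f s) * exp (- (s / R)\<^sup>2 / 8) \<le> \<kappa> * norm (fourier_on N g s)"
  shows "m\<^sup>2 \<le> 96 * (L / R)\<^sup>2 + 24 * (\<kappa> * B)\<^sup>2"
proof -
  define R' where "R' = sqrt 2 * R"
  have R': "R' > 0"
    using R by (simp add: R'_def)
  have N0: "N > 0"
    using N R by (smt (verit) divide_pos_pos)
  have "(\<integral>s. normal_density 0 R s * (norm (fourier_on N f s))\<^sup>2 \<partial>lborel)
      \<le> (\<integral>s. sqrt 2 * \<kappa>\<^sup>2 * (normal_density 0 R' s * (norm (fourier_on N g s))\<^sup>2) \<partial>lborel)"
  proof (rule integral_mono)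
    fix s :: real
    \<comment> \<open>The weight of width \<open>R\<close> is the weight of width \<open>sqrt 2 R\<close> times \<open>exp (-(s/R)\<^sup>2/4)\<close>, and
      the latter factor is the square of the one in the hypothesis.\<close>
    have split: "normal_density 0 R s = sqrt 2 * normal_density 0 R' s * (exp (- (s / R)\<^sup>2 / 8))\<^sup>2"
    proof -
      have "(exp (- (s / R)\<^sup>2 / 8))\<^sup>2 = exp (- s\<^sup>2 / (4 * R\<^sup>2))"
        by (simp add: power_divide flip: exp_double)
      moreover have "exp (- s\<^sup>2 / (2 * R\<^sup>2)) = exp (- s\<^sup>2 / (4 * R\<^sup>2)) * exp (- s\<^sup>2 / (4 * R\<^sup>2))"
        by (simp flip: exp_add)
      moreover have "x / (sqrt 2 * y) = sqrt 2 * x / (2 * y)" for x y :: real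
      proof -
        have "sqrt 2 * x / (2 * y) = (sqrt 2 * x) / (sqrt 2 * (sqrt 2 * y))"
          by (simp flip: mult.assoc)
        then show ?thesis by simp
      qed
      ultimately show ?thesis
        using R by (simp add: normal_density_def R'_def power_mult_distrib real_sqrt_mult mult.assoc)
    qed
    have "(norm (fourier_on N f s) * exp (- (s / R)\<^sup>2 / 8))\<^sup>2 \<le> (\<kappa> * norm (fourier_on N g s))\<^sup>2"
      by (intro power_mono FG) auto
    then have "sqrt 2 * normal_density 0 R' s * (norm (fourier_on N f s) * exp (- (s / R)\<^sup>2 / 8))\<^sup>2
        \<le> sqrt 2 * normal_density 0 R' s * (\<kappa> * norm (fourier_on N g s))\<^sup>2"
      by (intro mult_left_mono) auto
    then show "normal_density 0 R s * (norm (fourier_on N f s))\<^sup>2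
        \<le> sqrt 2 * \<kappa>\<^sup>2 * (normal_density 0 R' s * (norm (fourier_on N g s))\<^sup>2)"
      unfolding split by (simp add: power_mult_distrib mult_ac)
  qed (use gaussian_plancherel(1)[OF f R] gaussian_plancherel(1)[OF g R'] in auto)
  also have "\<dots> \<le> sqrt 2 * \<kappa>\<^sup>2 * (3 * B\<^sup>2 * N / R')"
  proof -
    have "(\<integral>s. normal_density 0 R' s * (norm (fourier_on N g s))\<^sup>2 \<partial>lborel) \<le> 3 * B\<^sup>2 * N / R'"
      using N0 by (intro gaussian_energy_le g R' B) auto
    then show ?thesis
      unfolding integral_mult_right_zero by (intro mult_left_mono) auto
  qed
  also have "\<dots> = N / (8 * R) * (24 * (\<kappa> * B)\<^sup>2)"
    using R by (simp add: R'_def field_simps power_mult_distrib)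
  finally have "N / (8 * R) * (m\<^sup>2 - 96 * L\<^sup>2 / R\<^sup>2) \<le> N / (8 * R) * (24 * (\<kappa> * B)\<^sup>2)"
    using gaussian_energy_ge[OF f R N L m m0] by linarith
  then have "m\<^sup>2 - 96 * L\<^sup>2 / R\<^sup>2 \<le> 24 * (\<kappa> * B)\<^sup>2"
    by (rule mult_left_le_imp_le) (use N0 R in simp)
  then show ?thesis
    by (simp add: power_divide)
qed

section \<open>Orbits and the resolvent on the imaginary axis\<close>

text \<open>
  The bound \<open>K\<close> is taken to be at least 1 so that division by it and multiplication of error terms
  with it are harmless.
\<close>

locale bounded_semigroup_off_axis =
  fixes T :: "real \<Rightarrow> 'a::chilbert_space \<Rightarrow> 'a" and D :: "'a set" and A :: "'a \<Rightarrow> 'a" and K :: real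
  assumes C0: "C0_semigroup T"
    and norm_T: "t \<ge> 0 \<Longrightarrow> norm (T t x) \<le> K * norm x"
    and K: "K \<ge> 1"
    and gen: "is_generator T D (\<lambda>x. - A x)"
    and off_axis: "spectrum D A \<inter> {z. Re z = 0} = {}"
begin

lemma T_bounded_linear: "t \<ge> 0 \<Longrightarrow> bounded_linear (T t)"
  and T_scaleC: "t \<ge> 0 \<Longrightarrow> T t (c *\<^sub>C x) = c *\<^sub>C T t x"
  and T_0: "T 0 x = x"
  and T_add: "r \<ge> 0 \<Longrightarrow> t \<ge> 0 \<Longrightarrow> T (r + t) x = T r (T t x)"
  and T_at_0: "((\<lambda>t. T t x) \<longlongrightarrow> x) (at_right 0)"
  using C0 by (auto simp: C0_semigroup_def bounded_clinear_def)

text \<open>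
  Increments start from the earlier of the two times, so that they are controlled by the behaviour
  of the semigroup at 0. Continuity and differentiability from the left rest on this.
\<close>

lemma T_increment:
  assumes "0 \<le> r" "r \<le> t"
  shows "T t x - T r x = T r (T (t - r) x - x)"
  using T_add[of r "t - r" x] assms linear_diff[OF bounded_linear.linear[OF T_bounded_linear], of r]
  by simp

lemma T_continuous: "continuous_on {0..} (\<lambda>t. T t x)"
  unfolding continuous_on_iff
proof (intro ballI allI impI)
  fix t e :: real assume t: "t \<in> {0..}" and e: "e > 0"
  have "\<forall>\<^sub>F h in at_right 0. dist (T h x) x < e / K"
    using T_at_0[of x] e K by (auto simp: tendsto_iff)
  then obtain d where d: "d > 0" "\<And>h. 0 < h \<Longrightarrow> h < d \<Longrightarrow> norm (T h x - x) < e / K"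
    unfolding eventually_at_right_field dist_norm by blast
  have *: "norm (T v x - T u x) < e" if "0 \<le> u" "u \<le> v" "v - u < d" for u v
  proof (cases "u = v")
    case False
    have "norm (T v x - T u x) \<le> K * norm (T (v - u) x - x)"
      using that by (simp add: T_increment norm_T)
    also have "\<dots> < e"
      using d(2)[of "v - u"] that False K by (simp add: field_simps)
    finally show ?thesis .
  qed (use e in auto)
  have "dist (T r x) (T t x) < e" if "r \<ge> 0" "dist r t < d" for r
    using *[of r t] *[of t r] t that by (cases "r \<le> t") (auto simp: dist_norm norm_minus_commute)
  then show "\<exists>d>0. \<forall>r\<in>{0..}. dist r t < d \<longrightarrow> dist (T r x) (T t x) < e"
    using d(1) by auto
qed

lemma T_continuous_interval: "continuous_on {0..N} (\<lambda>t. T t x)"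
  by (rule continuous_on_subset[OF T_continuous]) auto

lemma generator_tendsto: "x \<in> D \<Longrightarrow> ((\<lambda>h. (T h x - x) /\<^sub>R h) \<longlongrightarrow> - A x) (at_right 0)"
  using gen by (auto simp: is_generator_def)

lemma domain_invariant:
  assumes x: "x \<in> D" and t: "t \<ge> 0"
  shows "T t x \<in> D" and "A (T t x) = T t (A x)"
proof -
  interpret Tt: bounded_linear "T t"
    by (rule T_bounded_linear[OF t])
  have "((\<lambda>h. T t ((T h x - x) /\<^sub>R h)) \<longlongrightarrow> T t (- A x)) (at_right 0)"
    by (intro Tt.tendsto generator_tendsto x)
  moreover have "\<forall>\<^sub>F h in at_right 0. T t ((T h x - x) /\<^sub>R h) = (T h (T t x) - T t x) /\<^sub>R h"
    using eventually_at_right_less[of 0]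
  proof eventually_elim
    case (elim h)
    then show ?case
      using T_add[of h t x] T_add[of t h x] t by (simp add: Tt.scaleR Tt.diff add.commute)
  qed
  ultimately have lim: "((\<lambda>h. (T h (T t x) - T t x) /\<^sub>R h) \<longlongrightarrow> - T t (A x)) (at_right 0)"
    by (simp add: tendsto_cong Tt.neg)
  then show D: "T t x \<in> D"
    using gen by (auto simp: is_generator_def)
  have "- A (T t x) = - T t (A x)"
    by (rule tendsto_unique[OF _ generator_tendsto[OF D] lim]) simp
  then show "A (T t x) = T t (A x)" by simp
qed

text \<open>
  The generator only gives the derivative at 0 from the right. For \<open>r < t\<close> the increment is
  \<open>T r (T h x - x)\<close> with \<open>h = t - r\<close>, whereas the expected derivative is \<open>- T r (T h (A x))\<close>; the
  mismatch \<open>T h (A x) - A x\<close> vanishes by strong continuity.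
\<close>

lemma T_has_derivative:
  assumes x: "x \<in> D" and t: "t \<ge> 0"
  shows "((\<lambda>t. T t x) has_vector_derivative - T t (A x)) (at t within {0..})"
proof -
  define \<phi> where "\<phi> = (\<lambda>h. K * (norm ((T h x - x) /\<^sub>R h - (- A x)) + norm (T h (A x) - A x)))"
  have est: "norm (T r x - T t x - (r - t) *\<^sub>R - T t (A x)) / norm (r - t) \<le> \<phi> \<bar>r - t\<bar>"
    if r: "r \<ge> 0" "r \<noteq> t" for r
  proof -
    define h where "h = \<bar>r - t\<bar>"
    have h: "h > 0"
      using r by (simp add: h_def)
    define u where "u = min r t"
    have u: "u \<ge> 0"
      using r t by (simp add: u_def)
    interpret Tu: bounded_linear "T u"
      by (rule T_bounded_linear[OF u])
    have dq: "T h x - x = h *\<^sub>R ((T h x - x) /\<^sub>R h)"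
      using h by simp
    have "norm (T r x - T t x - (r - t) *\<^sub>R - T t (A x)) \<le> h * \<phi> h"
    proof (cases "r \<ge> t")
      case True
      then have "T r x - T t x - (r - t) *\<^sub>R - T t (A x) = T u (h *\<^sub>R ((T h x - x) /\<^sub>R h - (- A x)))"
        using T_increment[OF t True, of x] h
        by (simp add: u_def h_def scaleR_diff_right[symmetric] scaleR_add_right linear_add linear_scale
            bounded_linear.linear[OF T_bounded_linear[OF t]])
      then have "norm (T r x - T t x - (r - t) *\<^sub>R - T t (A x)) \<le> K * (h * norm ((T h x - x) /\<^sub>R h - (- A x)))"
        using norm_T[OF u, of "h *\<^sub>R ((T h x - x) /\<^sub>R h - (- A x))"] h by simp
      also have "\<dots> \<le> h * \<phi> h"
        using h K by (simp add: \<phi>_def algebra_simps)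
      finally show ?thesis .
    next
      case False
      have "T t (A x) = T u (T h (A x))"
        using T_add[of u h "A x"] u h False by (simp add: u_def h_def)
      moreover have "T r x = T t x - T u (T h x - x)"
        using T_increment[of r t x] False r by (simp add: u_def h_def algebra_simps)
      moreover have "h *\<^sub>R ((T h x - x) /\<^sub>R h - (- A x) + (T h (A x) - A x)) = (T h x - x) + h *\<^sub>R T h (A x)"
        using h by (simp add: scaleR_add_right scaleR_diff_right)
      moreover have "r - t = - h"
        using False by (simp add: h_def)
      ultimately have "T r x - T t x - (r - t) *\<^sub>R - T t (A x)
          = - T u (h *\<^sub>R ((T h x - x) /\<^sub>R h - (- A x) + (T h (A x) - A x)))"
        by (simp only:) (simp add: Tu.add Tu.scaleR)
      then have "norm (T r x - T t x - (r - t) *\<^sub>R - T t (A x))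
          \<le> K * (h * norm ((T h x - x) /\<^sub>R h - (- A x) + (T h (A x) - A x)))"
        using norm_T[OF u, of "h *\<^sub>R ((T h x - x) /\<^sub>R h - (- A x) + (T h (A x) - A x))"] h by simp
      also have "\<dots> \<le> K * (h * (norm ((T h x - x) /\<^sub>R h - (- A x)) + norm (T h (A x) - A x)))"
        using h K by (intro mult_left_mono norm_triangle_ineq) auto
      also have "\<dots> = h * \<phi> h"
        by (simp add: \<phi>_def)
      finally show ?thesis .
    qed
    then show ?thesis
      using h by (simp add: h_def field_simps)
  qed
  have "(\<phi> \<longlongrightarrow> K * (norm ((- A x) - (- A x)) + norm (A x - A x))) (at_right 0)"
    unfolding \<phi>_def by (intro tendsto_intros generator_tendsto x T_at_0)
  moreover have "filterlim (\<lambda>r. \<bar>r - t\<bar>) (at_right 0) (at t within {0..})"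
    unfolding filterlim_at
  proof
    have "((\<lambda>r. \<bar>r - t\<bar>) \<longlongrightarrow> \<bar>t - t\<bar>) (at t within {0..})"
      by (intro tendsto_intros)
    then show "((\<lambda>r. \<bar>r - t\<bar>) \<longlongrightarrow> 0) (at t within {0..})" by simp
  qed (auto simp: eventually_at_filter)
  ultimately have "((\<lambda>r. \<phi> \<bar>r - t\<bar>) \<longlongrightarrow> 0) (at t within {0..})"
    using filterlim_compose by fastforce
  then have "((\<lambda>r. norm (T r x - T t x - (r - t) *\<^sub>R - T t (A x)) / norm (r - t)) \<longlongrightarrow> 0) (at t within {0..})"
  proof (rule Lim_null_comparison[rotated])
    show "\<forall>\<^sub>F r in at t within {0..}. norm (norm (T r x - T t x - (r - t) *\<^sub>R - T t (A x)) / norm (r - t)) \<le> \<phi> \<bar>r - t\<bar>"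
      using est by (auto simp: eventually_at_filter)
  qed
  then show ?thesis
    unfolding has_vector_derivative_def has_derivative_iff_norm
    using bounded_linear_scaleR_left by blast
qed

definition res :: "real \<Rightarrow> 'a \<Rightarrow> 'a"
  where "res s = inv_into D (\<lambda>x. (\<i> * complex_of_real s) *\<^sub>C x + A x)"

lemma res_0: "res 0 = inv_into D A"
  by (simp add: res_def)

text \<open>
  The spectrum is that of \<open>A\<close>, so the operator \<open>\<i>s + A\<close> belongs to the point \<open>-\<i>s\<close> and is the negative
  of the operator in the definition of the resolvent set.
\<close>

lemma res_bij: "bij_betw (\<lambda>x. (\<i> * complex_of_real s) *\<^sub>C x + A x) D UNIV"
  and res_bounded_clinear: "bounded_clinear (res s)"
proof -
  let ?z = "- (\<i> * complex_of_real s)"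
  let ?P = "\<lambda>x. ?z *\<^sub>C x - A x" and ?Q = "\<lambda>x. (\<i> * complex_of_real s) *\<^sub>C x + A x"
  have "?z \<notin> spectrum D A"
    using off_axis by auto
  then have P: "bij_betw ?P D UNIV" and inv: "bounded_clinear (inv_into D ?P)"
    by (auto simp: spectrum_def resolvent_set_def)
  have Q: "?Q = uminus \<circ> ?P"
    by (auto simp: scaleC_minus_left)
  have bij: "bij_betw ?Q D UNIV"
    unfolding Q by (rule bij_betw_trans[OF P]) (auto intro!: bij_uminus)
  then show "bij_betw ?Q D UNIV" .
  have "res s y = inv_into D ?P (- y)" for y
    unfolding res_def
  proof (rule inv_into_f_eq)
    show "inj_on ?Q D"
      using bij by (rule bij_betw_imp_inj_on)
    show "inv_into D ?P (- y) \<in> D"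
      using P by (metis UNIV_I bij_betw_imp_surj_on inv_into_into)
    have "?P (inv_into D ?P (- y)) = - y"
      using P by (intro f_inv_into_f) (simp add: bij_betw_imp_surj_on)
    from arg_cong[OF this, of uminus] show "?Q (inv_into D ?P (- y)) = y"
      by (simp add: scaleC_minus_left add.commute)
  qed
  then have res: "res s = inv_into D ?P \<circ> uminus"
    by (auto simp: fun_eq_iff)
  show "bounded_clinear (res s)"
    unfolding bounded_clinear_def res
  proof (intro conjI allI)
    show "bounded_linear (inv_into D ?P \<circ> uminus)"
      using inv bounded_linear_compose[OF _ bounded_linear_minus[OF bounded_linear_ident]]
      by (auto simp: bounded_clinear_def o_def)
    show "(inv_into D ?P \<circ> uminus) (c *\<^sub>C x) = c *\<^sub>C (inv_into D ?P \<circ> uminus) x" for c x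
      using inv by (simp add: bounded_clinear_def scaleC.minus_right[symmetric])
  qed
qed

lemma res_bounded_linear: "bounded_linear (res s)"
  and res_scaleC: "res s (c *\<^sub>C x) = c *\<^sub>C res s x"
  using res_bounded_clinear by (auto simp: bounded_clinear_def)

lemma res_in_domain: "res s w \<in> D"
  unfolding res_def by (rule inv_into_into) (simp add: bij_betw_imp_surj_on[OF res_bij])

lemma res_right: "(\<i> * complex_of_real s) *\<^sub>C res s w + A (res s w) = w"
  using bij_betw_inv_into_right[OF res_bij, of w s] by (simp add: res_def)

lemma res_left: "x \<in> D \<Longrightarrow> res s ((\<i> * complex_of_real s) *\<^sub>C x + A x) = x"
  using bij_betw_inv_into_left[OF res_bij, of x s] by (simp add: res_def)

lemma A_res_0: "A (res 0 w) = w"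
  using res_right[of 0 w] by simp

lemma res_T: "t \<ge> 0 \<Longrightarrow> res s (T t w) = T t (res s w)"
  using res_left[OF domain_invariant(1)[OF res_in_domain], of t s s w] domain_invariant(2)[OF res_in_domain, of t s w]
    arg_cong[OF res_right[of s w], of "T t"] linear_add[OF bounded_linear.linear[OF T_bounded_linear], of t]
  by (simp add: T_scaleC)

lemma norm_res: "norm (res s w) \<le> onorm (res s) * norm w"
  by (rule onorm[OF res_bounded_linear])

lemma onorm_res_nonneg: "onorm (res s) \<ge> 0"
  by (rule onorm_pos_le[OF res_bounded_linear])

text \<open>
  The first resolvent identity. Dividing by \<open>s\<close>, it shows that the smoothing factor \<open>A\<inverse>\<close> gains a
  factor \<open>1/\<bar>s\<bar>\<close> over the resolvent.
\<close>

lemma res_res_0: "(\<i> * complex_of_real s) *\<^sub>C res s (res 0 w) = res 0 w - res s w"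
  using res_left[OF res_in_domain[of 0 w], of s] linear_add[OF bounded_linear.linear[OF res_bounded_linear], of s]
  by (simp add: A_res_0 res_scaleC algebra_simps)

text \<open>
  Integration by parts: \<open>(e\<^sup>-\<^sup>i\<^sup>s\<^sup>t \<eta>(t) T(t)z)' = e\<^sup>-\<^sup>i\<^sup>s\<^sup>t (\<eta>'(t) T(t)z - \<eta>(t) T(t)(\<i>s + A)z)\<close>. A window vanishing
  at both ends turns this into \<open>fourier_on_windowed\<close>; the constant window 1 gives \<open>norm_le_orbit\<close>.
\<close>

lemma fourier_on_derivative:
  assumes N: "N \<ge> 0" and z: "z \<in> D"
    and \<eta>: "\<And>t. t \<in> {0..N} \<Longrightarrow> (\<eta> has_real_derivative \<eta>' t) (at t within {0..N})"
    and \<eta>': "continuous_on {0..N} \<eta>'"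
  shows "fourier_on N (\<lambda>t. \<eta>' t *\<^sub>R T t z) s
    = fourier_on N (\<lambda>t. \<eta> t *\<^sub>R T t ((\<i> * complex_of_real s) *\<^sub>C z + A z)) s
      + (cis (- s * N) * complex_of_real (\<eta> N)) *\<^sub>C T N z - complex_of_real (\<eta> 0) *\<^sub>C z"
proof -
  let ?is = "\<i> * complex_of_real s"
  let ?e = "\<lambda>t. cis (- s * t) * complex_of_real (\<eta> t)"
  let ?e' = "\<lambda>t. cis (- s * t) * (complex_of_real (\<eta>' t) - ?is * complex_of_real (\<eta> t))"
  have \<eta>c: "continuous_on {0..N} \<eta>"
    using \<eta> by (meson DERIV_continuous continuous_on_eq_continuous_within)
  have e: "(?e has_vector_derivative ?e' t) (at t within {0..N})" if t: "t \<in> {0..N}" for t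
  proof -
    have "((\<lambda>t. cis (- s * t)) has_vector_derivative (- s) *\<^sub>R (\<i> * cis (- s * t))) (at t within {0..N})"
    proof -
      have "(cis has_vector_derivative \<i> * cis (- s * t)) (at (- s * t) within (\<lambda>t. - s * t) ` {0..N})"
        unfolding has_vector_derivative_def
        by (rule has_derivative_eq_rhs[OF has_derivative_cis[OF has_derivative_ident]]) auto
      moreover have "((\<lambda>t. - s * t) has_vector_derivative (- s)) (at t within {0..N})"
        by (auto intro!: derivative_eq_intros simp: has_real_derivative_iff_has_vector_derivative[symmetric])
      ultimately show ?thesis
        using vector_diff_chain_within[of "\<lambda>t. - s * t" "- s" t "{0..N}" cis "\<i> * cis (- s * t)"]
        by (simp add: o_def)
    qed
    moreover have "((\<lambda>t. complex_of_real (\<eta> t)) has_vector_derivative complex_of_real (\<eta>' t)) (at t within {0..N})"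
      using \<eta>[OF t] by (intro has_vector_derivative_of_real) (simp add: has_real_derivative_iff_has_vector_derivative)
    ultimately have "(?e has_vector_derivative
        cis (- s * t) * complex_of_real (\<eta>' t) + (- s) *\<^sub>R (\<i> * cis (- s * t)) * complex_of_real (\<eta> t)) (at t within {0..N})"
      by (rule has_vector_derivative_mult)
    then show ?thesis
      by (simp add: scaleR_conv_of_real algebra_simps)
  qed
  have d: "((\<lambda>t. ?e t *\<^sub>C T t z) has_vector_derivative ?e t *\<^sub>C (- T t (A z)) + ?e' t *\<^sub>C T t z) (at t within {0..N})"
    if t: "t \<in> {0..N}" for t
    using t by (intro scaleC.has_vector_derivative e has_vector_derivative_within_subset[OF T_has_derivative[OF z]]) auto
  have split: "?e t *\<^sub>C (- T t (A z)) + ?e' t *\<^sub>C T t z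
      = cis (- s * t) *\<^sub>C (\<eta>' t *\<^sub>R T t z) - cis (- s * t) *\<^sub>C (\<eta> t *\<^sub>R T t (?is *\<^sub>C z + A z))"
    if t: "t \<in> {0..N}" for t
    using t linear_add[OF bounded_linear.linear[OF T_bounded_linear], of t]
    by (simp add: T_scaleC scaleC_scaleC scaleC_add_right scaleC_diff_left scaleC.minus_right algebra_simps
        flip: scaleC_of_real)
  have "((\<lambda>t. cis (- s * t) *\<^sub>C (\<eta>' t *\<^sub>R T t z) - cis (- s * t) *\<^sub>C (\<eta> t *\<^sub>R T t (?is *\<^sub>C z + A z)))
      has_integral ?e N *\<^sub>C T N z - ?e 0 *\<^sub>C T 0 z) {0..N}"
    using fundamental_theorem_of_calculus[OF N d] by (subst has_integral_cong[OF split[symmetric]]) auto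
  moreover have "((\<lambda>t. cis (- s * t) *\<^sub>C (\<eta>' t *\<^sub>R T t z) - cis (- s * t) *\<^sub>C (\<eta> t *\<^sub>R T t (?is *\<^sub>C z + A z)))
      has_integral fourier_on N (\<lambda>t. \<eta>' t *\<^sub>R T t z) s
        - fourier_on N (\<lambda>t. \<eta> t *\<^sub>R T t (?is *\<^sub>C z + A z)) s) {0..N}"
    unfolding fourier_on_def
    by (intro has_integral_diff integrable_integral integrable_continuous_real continuous_on_cis_scaleC
        continuous_intros \<eta>c \<eta>' T_continuous_interval)
  ultimately have "fourier_on N (\<lambda>t. \<eta>' t *\<^sub>R T t z) s
        - fourier_on N (\<lambda>t. \<eta> t *\<^sub>R T t (?is *\<^sub>C z + A z)) s = ?e N *\<^sub>C T N z - ?e 0 *\<^sub>C T 0 z"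
    by (rule has_integral_unique[rotated])
  then show ?thesis
    by (simp add: T_0 algebra_simps)
qed

lemma fourier_on_res:
  assumes N: "N \<ge> 0" and \<eta>: "continuous_on {0..N} \<eta>"
  shows "fourier_on N (\<lambda>t. \<eta> t *\<^sub>R T t (res s w)) s' = res s (fourier_on N (\<lambda>t. \<eta> t *\<^sub>R T t w) s')"
proof -
  have "(\<lambda>t. cis (- s' * t) *\<^sub>C (\<eta> t *\<^sub>R T t w)) integrable_on {0..N}"
    by (intro integrable_continuous_real continuous_on_cis_scaleC continuous_intros \<eta> T_continuous_interval)
  from integral_linear[OF this res_bounded_linear, of s]
  have "res s (fourier_on N (\<lambda>t. \<eta> t *\<^sub>R T t w) s')
      = integral {0..N} (\<lambda>t. res s (cis (- s' * t) *\<^sub>C (\<eta> t *\<^sub>R T t w)))"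
    by (simp add: fourier_on_def o_def)
  also have "\<dots> = fourier_on N (\<lambda>t. \<eta> t *\<^sub>R T t (res s w)) s'"
    unfolding fourier_on_def
    by (rule integral_cong) (simp add: res_scaleC res_T linear_scale[OF bounded_linear.linear[OF res_bounded_linear]])
  finally show ?thesis ..
qed

lemma fourier_on_windowed:
  assumes N: "N \<ge> 0" and \<eta>: "\<And>t. t \<in> {0..N} \<Longrightarrow> (\<eta> has_real_derivative \<eta>' t) (at t within {0..N})"
    and \<eta>': "continuous_on {0..N} \<eta>'" and bd: "\<eta> 0 = 0" "\<eta> N = 0"
  shows "fourier_on N (\<lambda>t. \<eta> t *\<^sub>R T t w) s = res s (fourier_on N (\<lambda>t. \<eta>' t *\<^sub>R T t w) s)"
  using fourier_on_derivative[OF N res_in_domain \<eta> \<eta>', of s w s] fourier_on_res[OF N \<eta>', of s w s]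
  by (simp add: bd res_right)

text \<open>
  This bounds the inverse of \<open>\<i>s + A\<close> from the smallness of a single orbit at a single time.
\<close>

lemma norm_le_orbit:
  assumes N: "N \<ge> 0" and z: "z \<in> D"
  shows "norm z \<le> norm (T N z) + N * K * norm ((\<i> * complex_of_real s) *\<^sub>C z + A z)"
proof -
  let ?y = "(\<i> * complex_of_real s) *\<^sub>C z + A z"
  have "z = fourier_on N (\<lambda>t. 1 *\<^sub>R T t ?y) s + cis (- s * N) *\<^sub>C T N z"
    using fourier_on_derivative[OF N z, of "\<lambda>_. 1" "\<lambda>_. 0" s]
    by (simp add: fourier_on_def algebra_simps scaleC.zero_right)
  moreover have "norm (fourier_on N (\<lambda>t. 1 *\<^sub>R T t ?y) s) \<le> K * norm ?y * (N - 0)"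
    unfolding fourier_on_def
    by (rule integral_bound[OF N continuous_on_cis_scaleC])
      (auto intro!: T_continuous_interval norm_T simp: norm_scaleC)
  ultimately show ?thesis
    using norm_triangle_ineq[of "fourier_on N (\<lambda>t. 1 *\<^sub>R T t ?y) s" "cis (- s * N) *\<^sub>C T N z"]
    by (simp add: norm_scaleC mult_ac)
qed

end

section \<open>Polynomial windows\<close>

text \<open>
  This is \<open>(x(1 - x))\<^sup>n\<close>, which vanishes to order \<open>n\<close> at both ends of the unit interval and therefore
  allows \<open>n\<close> integrations by parts without boundary terms.
\<close>

definition window :: "nat \<Rightarrow> real poly"
  where "window n = [:0, 1, -1:] ^ n"

text \<open>
  The \<open>j\<close>-th derivative of the window transported to \<open>[0,N]\<close>; each derivative costs a factor \<open>1/N\<close>.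
\<close>

definition scaled_window :: "nat \<Rightarrow> real \<Rightarrow> nat \<Rightarrow> real \<Rightarrow> real"
  where "scaled_window n N j t = poly ((pderiv ^^ j) (window n)) (t / N) / N ^ j"

lemma dvd_pderiv_window: "j \<le> n \<Longrightarrow> [:0, 1, -1:] ^ (n - j) dvd (pderiv ^^ j) (window n)"
proof (induction j)
  case 0
  then show ?case by (simp add: window_def)
next
  case (Suc j)
  then obtain r where r: "(pderiv ^^ j) (window n) = [:0, 1, -1:] ^ (n - j) * r"
    by (auto elim: dvdE)
  have "n - j = Suc (n - Suc j)"
    using Suc.prems by simp
  then have "(pderiv ^^ Suc j) (window n)
      = [:0, 1, -1:] ^ (n - Suc j) * ([:0, 1, -1:] * pderiv r + smult (of_nat (n - j)) (pderiv [:0, 1, -1:]) * r)"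
    by (simp add: r pderiv_mult pderiv_power_Suc algebra_simps del: power_Suc)
      (simp add: algebra_simps)
  then show ?case by simp
qed

lemma scaled_window_boundary:
  assumes "j < n" "N > 0"
  shows "scaled_window n N j 0 = 0" "scaled_window n N j N = 0"
proof -
  have "poly [:0, 1, -1:] x dvd poly ((pderiv ^^ j) (window n)) x" for x :: real
  proof -
    have "[:0, 1, -1:] dvd [:0, 1, -1:] ^ (n - j)"
      using assms by (intro dvd_power) auto
    also have "\<dots> dvd (pderiv ^^ j) (window n)"
      using assms by (intro dvd_pderiv_window) auto
    finally obtain k where "(pderiv ^^ j) (window n) = [:0, 1, -1:] * k"
      by (elim dvdE)
    then show ?thesis
      by (simp only: poly_mult dvd_triv_left)
  qed
  from this[of 0] this[of 1] show "scaled_window n N j 0 = 0" "scaled_window n N j N = 0"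
    using assms by (auto simp: scaled_window_def)
qed

lemma scaled_window_has_derivative:
  assumes "N > 0"
  shows "(scaled_window n N j has_real_derivative scaled_window n N (Suc j) t) (at t within S)"
proof -
  have "((\<lambda>t. poly ((pderiv ^^ j) (window n)) (t / N)) has_real_derivative
      poly (pderiv ((pderiv ^^ j) (window n))) (t / N) * (1 / N)) (at t within S)"
    using assms by (intro DERIV_chain2[OF poly_DERIV]) (auto intro!: derivative_eq_intros)
  from DERIV_cdivide[OF this, of "N ^ j"] show ?thesis
    unfolding scaled_window_def by (simp add: mult.commute)
qed

lemma scaled_window_continuous: "N > 0 \<Longrightarrow> continuous_on S (scaled_window n N j)"
  using scaled_window_has_derivative by (meson DERIV_continuous continuous_on_eq_continuous_within)

lemma scaled_window_bounded:
  obtains C where "C \<ge> 0" "\<And>N t. N > 0 \<Longrightarrow> t \<in> {0..N} \<Longrightarrow> \<bar>scaled_window n N j t\<bar> \<le> C / N ^ j"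
proof -
  have "bounded (poly ((pderiv ^^ j) (window n)) ` {0..1})"
    by (intro compact_imp_bounded compact_continuous_image continuous_intros) auto
  then obtain C where "\<forall>y\<in>poly ((pderiv ^^ j) (window n)) ` {0..1}. norm y \<le> C"
    unfolding bounded_iff by blast
  then have C: "\<bar>poly ((pderiv ^^ j) (window n)) x\<bar> \<le> C" if "x \<in> {0..1}" for x
    using that by auto
  show thesis
  proof
    show "C \<ge> 0"
      using C[of 0] by auto
    show "\<bar>scaled_window n N j t\<bar> \<le> C / N ^ j" if "N > 0" "t \<in> {0..N}" for N t
      using C[of "t / N"] that by (auto simp: scaled_window_def abs_divide intro!: divide_right_mono)
  qed
qed

lemma scaled_window_ge:
  assumes "N > 0" "t \<in> {N / 4..3 * N / 4}"
  shows "(3 / 16) ^ n \<le> scaled_window n N 0 t"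
proof -
  define x where "x = t / N"
  have x: "1 / 4 \<le> x" "x \<le> 3 / 4"
    using assms by (auto simp: x_def field_simps)
  have "0 \<le> (x - 1 / 4) * (3 / 4 - x)"
    using x by simp
  also have "\<dots> = x * (1 - x) - 3 / 16"
    by (simp add: field_simps)
  finally have "3 / 16 \<le> x * (1 - x)"
    by simp
  then have "(3 / 16) ^ n \<le> (x * (1 - x)) ^ n"
    by (intro power_mono) auto
  then show ?thesis
    by (simp add: scaled_window_def window_def x_def algebra_simps)
qed

section \<open>The decay estimate\<close>

context bounded_semigroup_off_axis
begin

text \<open>
  Each integration by parts trades a derivative of the window for a power of the resolvent.
\<close>

lemma fourier_on_scaled_window:
  assumes "N > 0" "j \<le> n"
  shows "fourier_on N (\<lambda>t. scaled_window n N 0 t *\<^sub>R T t w) s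
    = (res s ^^ j) (fourier_on N (\<lambda>t. scaled_window n N j t *\<^sub>R T t w) s)"
  using assms(2)
proof (induction j)
  case (Suc j)
  have "fourier_on N (\<lambda>t. scaled_window n N j t *\<^sub>R T t w) s
      = res s (fourier_on N (\<lambda>t. scaled_window n N (Suc j) t *\<^sub>R T t w) s)"
    using assms(1) Suc.prems
    by (intro fourier_on_windowed scaled_window_has_derivative scaled_window_continuous scaled_window_boundary) auto
  then show ?case
    using Suc by (simp add: funpow_swap1)
qed simp

lemma norm_res_res_0:
  assumes b: "onorm (res s) \<le> b" "1 \<le> b" and a: "onorm (res 0) \<le> a" "1 \<le> a"
  shows "norm (res s (res 0 w)) \<le> 3 * a * b / (1 + \<bar>s\<bar>) * norm w"
proof -
  have s: "norm (res s v) \<le> b * norm v" and 0: "norm (res 0 v) \<le> a * norm v" for v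
    using norm_res[of s v] norm_res[of 0 v] b(1) a(1) mult_right_mono[of _ _ "norm v"] by (meson norm_ge_zero order_trans)+
  have "\<bar>s\<bar> * norm (res s (res 0 w)) = norm (res 0 w - res s w)"
    by (metis res_res_0 norm_scaleC norm_mult norm_ii norm_of_real mult_1)
  also have "\<dots> \<le> a * norm w + b * norm w"
    using norm_triangle_ineq4[of "res 0 w" "res s w"] s[of w] 0[of w] by linarith
  also have "\<dots> \<le> a * b * norm w + a * b * norm w"
    using a b mult_mono[of 1 a b b] mult_mono[of a a 1 b] by (intro add_mono mult_right_mono) auto
  finally have "\<bar>s\<bar> * norm (res s (res 0 w)) \<le> a * b * norm w + a * b * norm w" .
  then have "(1 + \<bar>s\<bar>) * norm (res s (res 0 w)) \<le> 3 * (a * b * norm w)"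
  proof -
    have "b * norm (res 0 w) \<le> b * (a * norm w)"
      using 0 b by (intro mult_left_mono) auto
    then show ?thesis
      using s[of "res 0 w"] \<open>\<bar>s\<bar> * norm (res s (res 0 w)) \<le> a * b * norm w + a * b * norm w\<close>
      by (simp add: algebra_simps)
  qed
  then show ?thesis
    by (simp add: field_simps)
qed

lemma norm_res_power:
  assumes b: "onorm (res s) \<le> b" "1 \<le> b"
  shows "norm ((res s ^^ k) v) \<le> b ^ k * norm v"
proof (induction k)
  case (Suc k)
  have "norm (res s ((res s ^^ k) v)) \<le> b * norm ((res s ^^ k) v)"
    using norm_res[of s "(res s ^^ k) v"] b(1) mult_right_mono[OF b(1), of "norm ((res s ^^ k) v)"] by simp
  also have "\<dots> \<le> b * (b ^ k * norm v)"
    using Suc b by (intro mult_left_mono) auto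
  finally show ?case by simp
qed simp

lemma windowed_orbit_lipschitz:
  assumes N: "N > 0" and y: "y \<in> D"
    and C: "\<And>t. t \<in> {0..N} \<Longrightarrow> \<bar>scaled_window n N 0 t\<bar> \<le> C0" "\<And>t. t \<in> {0..N} \<Longrightarrow> \<bar>scaled_window n N 1 t\<bar> \<le> C1"
    and tr: "t \<in> {0..N}" "r \<in> {0..N}"
  shows "norm (scaled_window n N 0 t *\<^sub>R T t y - scaled_window n N 0 r *\<^sub>R T r y)
    \<le> K * (C1 * norm y + C0 * norm (A y)) * \<bar>t - r\<bar>"
proof -
  let ?f' = "\<lambda>t. scaled_window n N 0 t *\<^sub>R (- T t (A y)) + scaled_window n N 1 t *\<^sub>R T t y"
  have "((\<lambda>t. scaled_window n N 0 t *\<^sub>R T t y) has_vector_derivative ?f' t) (at t within {0..N})"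
    if "t \<in> {0..N}" for t
    using that scaled_window_has_derivative[OF N, of n 0]
    by (intro has_vector_derivative_scaleR has_vector_derivative_within_subset[OF T_has_derivative[OF y]]) auto
  moreover have "onorm (\<lambda>h. h *\<^sub>R ?f' t) \<le> K * (C1 * norm y + C0 * norm (A y))" if t: "t \<in> {0..N}" for t
  proof (rule onorm_bound)
    have C0: "C0 \<ge> 0" "C1 \<ge> 0"
      using C[OF t] by auto
    then show "0 \<le> K * (C1 * norm y + C0 * norm (A y))"
      using K by simp
    fix h :: real
    have "norm (?f' t) \<le> norm (scaled_window n N 0 t *\<^sub>R (- T t (A y))) + norm (scaled_window n N 1 t *\<^sub>R T t y)"
      by (rule norm_triangle_ineq)
    also have "\<dots> \<le> C0 * (K * norm (A y)) + C1 * (K * norm y)"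
      using C[OF t] C0 norm_T[of t] t by (auto intro!: add_mono mult_mono)
    also have "\<dots> = K * (C1 * norm y + C0 * norm (A y))"
      by (simp add: algebra_simps)
    finally have "norm h * norm (?f' t) \<le> norm h * (K * (C1 * norm y + C0 * norm (A y)))"
      by (rule mult_left_mono) simp
    then show "norm (h *\<^sub>R ?f' t) \<le> K * (C1 * norm y + C0 * norm (A y)) * norm h"
      by (simp only: norm_scaleR real_norm_def mult.commute)
  qed
  ultimately show ?thesis
    using differentiable_bound[of "{0..N}" "\<lambda>t. scaled_window n N 0 t *\<^sub>R T t y" "\<lambda>t h. h *\<^sub>R ?f' t"
        "K * (C1 * norm y + C0 * norm (A y))" t r] tr
    by (simp add: has_vector_derivative_def)
qed

text \<open>
  The function \<open>f(t) = \<eta>(t) T(t) A\<inverse> x\<close> has the transform \<open>R\<^sub>s\<^sup>n A\<inverse> G(s)\<close>, where \<open>G\<close> is the transform of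
  \<open>g(t) = \<eta>\<^sup>(\<^sup>n\<^sup>)(t) T(t) x\<close>. Here \<open>g\<close> has size \<open>N\<^sup>-\<^sup>n\<close>, the multiplier has size \<open>\<parallel>R\<^sub>s\<parallel>\<^sup>n / (1 + \<bar>s\<bar>)\<close>, and
  \<open>f\<close> is Lipschitz uniformly in \<open>N\<close>, because the unbounded operator \<open>A\<close> meets \<open>A\<inverse>\<close>. On the middle
  half of \<open>[0,N]\<close>, the norm of \<open>f\<close> is bounded below by a multiple of \<open>\<parallel>T(N) A\<inverse> x\<parallel>\<close>. So the comparison
  of transforms gives the result.
\<close>

theorem decay_estimate:
  fixes b :: "real \<Rightarrow> real"
  assumes n: "n \<ge> 1" and b: "\<And>s. onorm (res s) \<le> b s" "\<And>s. 1 \<le> b s"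
  obtains C where "C \<ge> 0"
    "\<And>R N \<kappa>. R \<ge> 1 \<Longrightarrow> N \<ge> 2 \<Longrightarrow> (\<And>s. b s ^ n / (1 + \<bar>s\<bar>) * exp (- (s / R)\<^sup>2 / 8) \<le> \<kappa>)
      \<Longrightarrow> onorm (T N \<circ> res 0) \<le> C * (\<kappa> / N ^ n + 1 / R)"
proof -
  obtain C0 where C0: "C0 \<ge> 0" "\<And>N t. N > 0 \<Longrightarrow> t \<in> {0..N} \<Longrightarrow> \<bar>scaled_window n N 0 t\<bar> \<le> C0 / N ^ 0"
    using scaled_window_bounded by metis
  obtain C1 where C1: "C1 \<ge> 0" "\<And>N t. N > 0 \<Longrightarrow> t \<in> {0..N} \<Longrightarrow> \<bar>scaled_window n N 1 t\<bar> \<le> C1 / N ^ 1"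
    using scaled_window_bounded by metis
  obtain Cn where Cn: "Cn \<ge> 0" "\<And>N t. N > 0 \<Longrightarrow> t \<in> {0..N} \<Longrightarrow> \<bar>scaled_window n N n t\<bar> \<le> Cn / N ^ n"
    using scaled_window_bounded by metis
  define a where "a = max 1 (onorm (res 0))"
  have a: "onorm (res 0) \<le> a" "1 \<le> a"
    by (auto simp: a_def)
  \<comment> \<open>The factor \<open>(16/3)\<^sup>n\<close> is the reciprocal of the minimum of the window on the middle half. The
    constants 96 and 24 of the comparison of transforms have square roots below 10 and 5, and 15
    contains the factor 3 of \<open>norm_res_res_0\<close>.\<close>
  define C where "C = K * (16 / 3) ^ n * (10 * (K * (C1 * a + C0)) + 15 * (a * Cn * K))"
  have key: "onorm (T N \<circ> res 0) \<le> C * (\<kappa> / N ^ n + 1 / R)"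
    if R: "R \<ge> 1" and N: "N \<ge> 2" and \<kappa>: "\<And>s. b s ^ n / (1 + \<bar>s\<bar>) * exp (- (s / R)\<^sup>2 / 8) \<le> \<kappa>" for R N \<kappa>
  proof -
    have "0 \<le> b 0 ^ n / (1 + \<bar>0\<bar>) * exp (- (0 / R)\<^sup>2 / 8)"
      using b(2)[of 0] by simp
    then have \<kappa>0: "\<kappa> \<ge> 0"
      using \<kappa>[of 0] by linarith
    have pointwise: "norm (T N (res 0 x)) \<le> C * (\<kappa> / N ^ n + 1 / R) * norm x" for x
    proof -
      define f where "f = (\<lambda>t. scaled_window n N 0 t *\<^sub>R T t (res 0 x))"
      define g where "g = (\<lambda>t. scaled_window n N n t *\<^sub>R T t x)"
      define m where "m = (3 / 16) ^ n * (norm (T N (res 0 x)) / K)"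
      define L where "L = K * (C1 * a + C0) * norm x"
      define B where "B = Cn / N ^ n * (K * norm x)"
      have resx: "norm (res 0 x) \<le> a * norm x"
        using norm_res[of 0 x] mult_right_mono[OF a(1), of "norm x"] by simp
      have pos: "L \<ge> 0" "B \<ge> 0" "m \<ge> 0"
        using C0(1) C1(1) Cn(1) a K N by (auto simp: L_def B_def m_def)
      have "m\<^sup>2 \<le> 96 * (L / R)\<^sup>2 + 24 * ((3 * a * \<kappa>) * B)\<^sup>2"
      proof (rule fourier_comparison[where f = f and g = g and N = N])
        show "continuous_on {0..N} f" "continuous_on {0..N} g"
          unfolding f_def g_def using N
          by (auto intro!: continuous_intros scaled_window_continuous T_continuous_interval)
        show "0 < R" "0 \<le> m"
          using R pos by auto
        show "2 / R \<le> N"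
          using R N by (simp add: field_simps) (smt (verit) mult_le_cancel_left1)
        show "norm (f t - f r) \<le> L * \<bar>t - r\<bar>" if tr: "t \<in> {0..N}" "r \<in> {0..N}" for t r
        proof -
          have "C1 / N ^ 1 \<le> C1"
            using C1(1) N by (simp add: divide_le_eq mult_le_cancel_left1)
          then have "norm (f t - f r) \<le> K * (C1 * norm (res 0 x) + C0 * norm (A (res 0 x))) * \<bar>t - r\<bar>"
            unfolding f_def using C0(2)[of N] C1(2)[of N] N
            by (intro windowed_orbit_lipschitz res_in_domain tr) force+
          also have "\<dots> \<le> K * (C1 * (a * norm x) + C0 * norm x) * \<bar>t - r\<bar>"
            using K C1(1) resx by (intro mult_right_mono mult_left_mono add_mono) (auto simp: A_res_0 C0(1))
          finally show ?thesis
            by (simp add: L_def algebra_simps)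
        qed
        show "m \<le> norm (f t)" if t: "t \<in> {N / 4..3 * N / 4}" for t
        proof -
          have "T N (res 0 x) = T (N - t) (T t (res 0 x))"
            using T_add[of "N - t" t] t N by simp
          then have "norm (T N (res 0 x)) \<le> K * norm (T t (res 0 x))"
            using norm_T[of "N - t"] t N by simp
          then have "norm (T N (res 0 x)) / K \<le> norm (T t (res 0 x))"
            using K by (simp add: field_simps)
          moreover have "(3 / 16) ^ n \<le> \<bar>scaled_window n N 0 t\<bar>"
            using scaled_window_ge[OF _ t, of n] N by simp
          ultimately show ?thesis
            unfolding m_def f_def norm_scaleR real_norm_def using K by (intro mult_mono) auto
        qed
        show "norm (g t) \<le> B" if "t \<in> {0..N}" for t
          unfolding g_def B_def norm_scaleR real_norm_def using Cn N that
          by (intro mult_mono norm_T) auto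
        show "norm (fourier_on N f s) * exp (- (s / R)\<^sup>2 / 8) \<le> 3 * a * \<kappa> * norm (fourier_on N g s)" for s
        proof -
          let ?G = "fourier_on N g s"
          obtain k where k: "n = Suc k"
            using n by (cases n) auto
          have comm: "fourier_on N (\<lambda>t. scaled_window n N n t *\<^sub>R T t (res 0 x)) s = res 0 ?G"
            unfolding g_def using N by (intro fourier_on_res scaled_window_continuous) auto
          have "fourier_on N f s = (res s ^^ n) (res 0 ?G)"
            unfolding f_def using N fourier_on_scaled_window[of N n n] comm by simp
          also have "\<dots> = (res s ^^ k) (res s (res 0 ?G))"
            by (simp add: k funpow_swap1)
          finally have "norm (fourier_on N f s) \<le> b s ^ k * norm (res s (res 0 ?G))"
            using norm_res_power[OF b] by simp
          also have "\<dots> \<le> b s ^ k * (3 * a * b s / (1 + \<bar>s\<bar>) * norm ?G)"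
            using b(2)[of s] by (intro mult_left_mono norm_res_res_0 b a) auto
          also have "\<dots> = b s ^ n / (1 + \<bar>s\<bar>) * (3 * a * norm ?G)"
            by (simp add: k)
          finally have "norm (fourier_on N f s) * exp (- (s / R)\<^sup>2 / 8)
              \<le> b s ^ n / (1 + \<bar>s\<bar>) * (3 * a * norm ?G) * exp (- (s / R)\<^sup>2 / 8)"
            by (intro mult_right_mono) auto
          also have "\<dots> = b s ^ n / (1 + \<bar>s\<bar>) * exp (- (s / R)\<^sup>2 / 8) * (3 * a * norm ?G)"
            by (simp only: mult_ac)
          also have "\<dots> \<le> \<kappa> * (3 * a * norm ?G)"
            using a by (intro mult_right_mono \<kappa>) auto
          finally show ?thesis
            by (simp only: mult_ac)
        qed
      qed
      also have "\<dots> \<le> (10 * (L / R) + 5 * (3 * a * \<kappa> * B))\<^sup>2"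
      proof -
        have *: "96 * u\<^sup>2 + 24 * v\<^sup>2 \<le> (10 * u + 5 * v)\<^sup>2" if "u \<ge> 0" "v \<ge> 0" for u v :: real
          using that by (simp add: power2_eq_square algebra_simps)
        show ?thesis
          by (rule *) (use pos R a \<kappa>0 in auto)
      qed
      finally have "m \<le> 10 * (L / R) + 5 * (3 * a * \<kappa> * B)"
        by (rule power2_le_imp_le) (use pos R a \<kappa>0 in auto)
      then have "K * (16 / 3) ^ n * m \<le> K * (16 / 3) ^ n * (10 * (L / R) + 5 * (3 * a * \<kappa> * B))"
        using K by (intro mult_left_mono) auto
      moreover have "K * (16 / 3) ^ n * m = norm (T N (res 0 x))"
      proof -
        have "(16 / 3 :: real) ^ n * (3 / 16) ^ n = 1"
          by (simp flip: power_mult_distrib)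
        moreover have "K * (16 / 3) ^ n * m = ((16 / 3) ^ n * (3 / 16) ^ n) * (K * (norm (T N (res 0 x)) / K))"
          by (simp only: m_def mult_ac)
        ultimately have "K * (16 / 3) ^ n * m = K * (norm (T N (res 0 x)) / K)"
          by simp
        then show ?thesis using K by simp
      qed
      moreover have "10 * (L / R) + 5 * (3 * a * \<kappa> * B)
          \<le> (10 * (K * (C1 * a + C0)) + 15 * (a * Cn * K)) * (\<kappa> / N ^ n + 1 / R) * norm x"
      proof -
        have *: "u * q + v * p \<le> (u + v) * (p + q)" if "u \<ge> 0" "v \<ge> 0" "p \<ge> 0" "q \<ge> 0" for u v p q :: real
          using that by (simp add: algebra_simps)
        have "10 * (K * (C1 * a + C0)) * (1 / R) + 15 * (a * Cn * K) * (\<kappa> / N ^ n)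
            \<le> (10 * (K * (C1 * a + C0)) + 15 * (a * Cn * K)) * (\<kappa> / N ^ n + 1 / R)"
          by (rule *) (use K C0(1) C1(1) Cn(1) a \<kappa>0 N R in auto)
        moreover have "10 * (L / R) + 5 * (3 * a * \<kappa> * B)
            = (10 * (K * (C1 * a + C0)) * (1 / R) + 15 * (a * Cn * K) * (\<kappa> / N ^ n)) * norm x"
          by (simp add: L_def B_def algebra_simps add_divide_distrib)
        ultimately show ?thesis
          by (simp only: mult_right_mono norm_ge_zero)
      qed
      then have "K * (16 / 3) ^ n * (10 * (L / R) + 5 * (3 * a * \<kappa> * B)) \<le> K * (16 / 3) ^ n *
          ((10 * (K * (C1 * a + C0)) + 15 * (a * Cn * K)) * (\<kappa> / N ^ n + 1 / R) * norm x)"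
        using K by (intro mult_left_mono) auto
      ultimately have "norm (T N (res 0 x)) \<le> K * (16 / 3) ^ n *
          ((10 * (K * (C1 * a + C0)) + 15 * (a * Cn * K)) * (\<kappa> / N ^ n + 1 / R) * norm x)"
        by linarith
      then show ?thesis
        by (simp add: C_def mult.assoc)
    qed
    have "C \<ge> 0"
      using K C0(1) C1(1) Cn(1) a by (simp add: C_def)
    then show ?thesis
      using pointwise \<kappa>0 N R by (intro onorm_bound) auto
  qed
  show thesis
    by (rule that[of C]) (use key K C0(1) C1(1) Cn(1) a in \<open>auto simp: C_def\<close>)
qed

end

section \<open>Powers with a logarithmic factor\<close>

definition powr_ln :: "real \<Rightarrow> real \<Rightarrow> real \<Rightarrow> real"
  where "powr_ln \<delta> \<gamma> x = x powr \<delta> * ln x powr \<gamma>"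

lemma powr_ln_pos: "x \<ge> 2 \<Longrightarrow> powr_ln \<delta> \<gamma> x > 0"
  by (simp add: powr_ln_def)

text \<open>
  Slow variation of the logarithm, with an explicit constant.
\<close>

lemma ln_le_powr_ratio:
  fixes \<eta> u v :: real
  assumes "\<eta> > 0" "2 \<le> v" "v \<le> u"
  shows "ln u \<le> (1 + 1 / (\<eta> * ln 2)) * (u / v) powr \<eta> * ln v"
proof -
  have r: "u / v \<ge> 1"
    using assms by simp
  then have pw: "(u / v) powr \<eta> \<ge> 1"
    using assms by (simp add: ge_one_powr_ge_zero)
  have lv: "ln v \<ge> ln 2" "ln 2 > (0::real)"
    using assms by auto
  have "ln u = ln v + ln (u / v)"
    using assms by (simp add: ln_div)
  also have "ln (u / v) \<le> (u / v) powr \<eta> / \<eta>"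
    using ln_powr_bound[OF r assms(1)] .
  also have "(u / v) powr \<eta> / \<eta> \<le> (u / v) powr \<eta> / \<eta> * (ln v / ln 2)"
    using mult_left_mono[of 1 "ln v / ln 2" "(u / v) powr \<eta> / \<eta>"] lv assms by simp
  also have "ln v + \<dots> \<le> (u / v) powr \<eta> * ln v + (u / v) powr \<eta> / \<eta> * (ln v / ln 2)"
  proof -
    have "0 \<le> ln v"
      using lv by linarith
    from mult_right_mono[OF pw this] show ?thesis by simp
  qed
  also have "\<dots> = (1 + 1 / (\<eta> * ln 2)) * (u / v) powr \<eta> * ln v"
    by (simp add: algebra_simps)
  finally show ?thesis by simp
qed

text \<open>
  The function need not be monotone near 2 when \<open>\<gamma> < 0\<close>, but as a positive power dominates the
  logarithm it is increasing up to a constant factor. In the other direction it grows at most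
  polynomially, with the generous exponent \<open>2\<delta>\<close>.
\<close>

lemma powr_ln_le:
  assumes \<delta>: "\<delta> > 0"
  obtains C where "C > 0"
    "\<And>x y. 2 \<le> x \<Longrightarrow> 2 \<le> y \<Longrightarrow> powr_ln \<delta> \<gamma> x \<le> C * powr_ln \<delta> \<gamma> y * (1 + x / y) powr (2 * \<delta>)"
    "\<And>x y. 2 \<le> x \<Longrightarrow> x \<le> y \<Longrightarrow> powr_ln \<delta> \<gamma> x \<le> C * powr_ln \<delta> \<gamma> y"
proof -
  define \<eta> where "\<eta> = \<delta> / (1 + \<bar>\<gamma>\<bar>)"
  have \<eta>: "\<eta> > 0" "\<eta> * \<bar>\<gamma>\<bar> \<le> \<delta>"
    using \<delta> by (auto simp: \<eta>_def field_simps)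
  define c where "c = 1 + 1 / (\<eta> * ln 2)"
  have c: "c \<ge> 1"
    using \<eta> by (simp add: c_def)
  define C where "C = c powr \<bar>\<gamma>\<bar>"
  have C: "C \<ge> 1"
    using c by (simp add: C_def ge_one_powr_ge_zero)
  have up: "powr_ln \<delta> \<gamma> x \<le> C * powr_ln \<delta> \<gamma> y * (x / y) powr (2 * \<delta>)" if xy: "2 \<le> y" "y \<le> x" for x y
  proof -
    have r: "x / y \<ge> 1"
      using xy by simp
    have "ln x powr \<gamma> \<le> C * (x / y) powr \<delta> * ln y powr \<gamma>"
    proof (cases "\<gamma> \<ge> 0")
      case True
      have "ln x powr \<gamma> \<le> (c * (x / y) powr \<eta> * ln y) powr \<gamma>"
        using ln_le_powr_ratio[OF \<eta>(1) xy] xy True by (intro powr_mono2) (auto simp: c_def)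
      also have "\<dots> = C * (x / y) powr (\<eta> * \<gamma>) * ln y powr \<gamma>"
        using c xy True by (simp add: powr_mult powr_powr C_def)
      also have "\<dots> \<le> C * (x / y) powr \<delta> * ln y powr \<gamma>"
        using C r \<eta> True by (intro mult_right_mono mult_left_mono powr_mono) auto
      finally show ?thesis .
    next
      case False
      have "ln x powr \<gamma> \<le> 1 * 1 * ln y powr \<gamma>"
        using False xy by (simp add: powr_mono2')
      also have "\<dots> \<le> C * (x / y) powr \<delta> * ln y powr \<gamma>"
        using C r \<delta> by (intro mult_right_mono mult_mono) (auto simp: ge_one_powr_ge_zero)
      finally show ?thesis .
    qed
    then have "x powr \<delta> * ln x powr \<gamma> \<le> x powr \<delta> * (C * (x / y) powr \<delta> * ln y powr \<gamma>)"
      by (intro mult_left_mono) auto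
    also have "\<dots> = C * (y powr \<delta> * ln y powr \<gamma>) * ((x / y) powr \<delta> * (x / y) powr \<delta>)"
    proof -
      have x: "x powr \<delta> = y powr \<delta> * (x / y) powr \<delta>"
        using xy by (simp add: powr_divide)
      show ?thesis
        unfolding x by (simp only: mult_ac)
    qed
    also have "(x / y) powr \<delta> * (x / y) powr \<delta> = (x / y) powr (2 * \<delta>)"
      by (simp flip: powr_add)
    finally show ?thesis
      by (simp add: powr_ln_def)
  qed
  have down: "powr_ln \<delta> \<gamma> x \<le> C * powr_ln \<delta> \<gamma> y" if xy: "2 \<le> x" "x \<le> y" for x y
  proof (cases "\<gamma> \<ge> 0")
    case True
    have "powr_ln \<delta> \<gamma> x \<le> powr_ln \<delta> \<gamma> y"
      unfolding powr_ln_def using xy True \<delta> by (intro mult_mono powr_mono2) auto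
    also have "\<dots> \<le> C * powr_ln \<delta> \<gamma> y"
      using C powr_ln_pos[of y \<delta> \<gamma>] xy mult_right_mono[of 1 C "powr_ln \<delta> \<gamma> y"] by simp
    finally show ?thesis .
  next
    case False
    have "(c * (y / x) powr \<eta> * ln x) powr \<gamma> \<le> ln y powr \<gamma>"
      using ln_le_powr_ratio[OF \<eta>(1) xy] xy False by (intro powr_mono2') (auto simp: c_def)
    moreover have "(c * (y / x) powr \<eta> * ln x) powr \<gamma> = c powr \<gamma> * (y / x) powr (\<eta> * \<gamma>) * ln x powr \<gamma>"
      using c xy by (simp add: powr_mult powr_powr)
    ultimately have "C * ((y / x) powr (- (\<eta> * \<gamma>)) * (c powr \<gamma> * (y / x) powr (\<eta> * \<gamma>) * ln x powr \<gamma>))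
        \<le> C * ((y / x) powr (- (\<eta> * \<gamma>)) * ln y powr \<gamma>)"
      using C by (intro mult_left_mono) auto
    moreover have "C * ((y / x) powr (- (\<eta> * \<gamma>)) * (c powr \<gamma> * (y / x) powr (\<eta> * \<gamma>) * ln x powr \<gamma>)) = ln x powr \<gamma>"
    proof -
      have "C * c powr \<gamma> = 1"
        using False c by (simp add: C_def flip: powr_add)
      moreover have "(y / x) powr (- (\<eta> * \<gamma>)) * (y / x) powr (\<eta> * \<gamma>) = 1"
        using xy by (simp flip: powr_add)
      moreover have "C * ((y / x) powr (- (\<eta> * \<gamma>)) * (c powr \<gamma> * (y / x) powr (\<eta> * \<gamma>) * ln x powr \<gamma>))
          = (C * c powr \<gamma>) * ((y / x) powr (- (\<eta> * \<gamma>)) * (y / x) powr (\<eta> * \<gamma>)) * ln x powr \<gamma>"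
        by (simp only: mult_ac)
      ultimately show ?thesis by simp
    qed
    moreover have "(y / x) powr (- (\<eta> * \<gamma>)) \<le> (y / x) powr \<delta>"
      using xy \<eta> False by (intro powr_mono) auto
    ultimately have "ln x powr \<gamma> \<le> C * ((y / x) powr \<delta> * ln y powr \<gamma>)"
      using C by (smt (verit) mult_left_mono mult_right_mono powr_ge_zero)
    then have "x powr \<delta> * ln x powr \<gamma> \<le> x powr \<delta> * (C * ((y / x) powr \<delta> * ln y powr \<gamma>))"
      by (intro mult_left_mono) auto
    also have "\<dots> = C * ((x powr \<delta> * (y / x) powr \<delta>) * ln y powr \<gamma>)"
      by (simp only: mult_ac)
    also have "x powr \<delta> * (y / x) powr \<delta> = y powr \<delta>"
      using xy by (simp add: powr_divide)
    finally show ?thesis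
      by (simp add: powr_ln_def)
  qed
  show thesis
  proof
    show "C > 0"
      using C by simp
    show "powr_ln \<delta> \<gamma> x \<le> C * powr_ln \<delta> \<gamma> y" if "2 \<le> x" "x \<le> y" for x y
      using that by (rule down)
    show "powr_ln \<delta> \<gamma> x \<le> C * powr_ln \<delta> \<gamma> y * (1 + x / y) powr (2 * \<delta>)" if xy: "2 \<le> x" "2 \<le> y" for x y
    proof (cases "y \<le> x")
      case True
      have "C * powr_ln \<delta> \<gamma> y * (x / y) powr (2 * \<delta>) \<le> C * powr_ln \<delta> \<gamma> y * (1 + x / y) powr (2 * \<delta>)"
        using C powr_ln_pos[of y \<delta> \<gamma>] xy \<delta> by (intro mult_left_mono powr_mono2) auto
      then show ?thesis
        using up[OF xy(2) True] by linarith
    next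
      case False
      have "C * powr_ln \<delta> \<gamma> y * 1 \<le> C * powr_ln \<delta> \<gamma> y * (1 + x / y) powr (2 * \<delta>)"
        using C powr_ln_pos[of y \<delta> \<gamma>] xy \<delta> by (intro mult_left_mono ge_one_powr_ge_zero) auto
      moreover have "powr_ln \<delta> \<gamma> x \<le> C * powr_ln \<delta> \<gamma> y"
        using False by (intro down xy) simp
      ultimately show ?thesis by simp
    qed
  qed
qed

text \<open>
  With \<open>ln (2 + z) \<le> 1 + z\<close> it remains to complete the square in \<open>p(1 + z) - z\<^sup>2/8\<close>.
\<close>

lemma powr_le_gaussian:
  fixes p z :: real
  assumes "p \<ge> 0" "z \<ge> 0"
  shows "(2 + z) powr p * exp (- z\<^sup>2 / 8) \<le> exp (p + 2 * p\<^sup>2)"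
proof -
  have "ln (2 + z) \<le> 1 + z"
    using ln_le_minus_one[of "2 + z"] assms by simp
  then have "p * ln (2 + z) \<le> p * (1 + z)"
    using assms by (intro mult_left_mono)
  moreover have "0 \<le> (z - 4 * p)\<^sup>2 / 8"
    by simp
  moreover have "(z - 4 * p)\<^sup>2 / 8 = z\<^sup>2 / 8 - p * z + 2 * p\<^sup>2"
    by (simp add: power2_eq_square field_simps)
  ultimately have "p * ln (2 + z) + - z\<^sup>2 / 8 \<le> p + 2 * p\<^sup>2"
    by (simp add: distrib_left)
  then show ?thesis
    using assms by (simp add: powr_def flip: exp_add)
qed

lemma locally_bounded_imp_bounded:
  fixes h :: "real \<Rightarrow> real"
  assumes "\<And>s. \<exists>d>0. \<exists>c. \<forall>s'. \<bar>s' - s\<bar> < d \<longrightarrow> h s' \<le> c"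
  obtains C where "\<And>s. \<bar>s\<bar> \<le> S \<Longrightarrow> h s \<le> C"
proof -
  obtain d c where dc: "\<And>s. d s > 0" "\<And>s s'. \<bar>s' - s\<bar> < d s \<Longrightarrow> h s' \<le> c s"
    using assms by metis
  have "compact {- S..S}" by simp
  then obtain F where F: "F \<subseteq> {- S..S}" "finite F" "{- S..S} \<subseteq> (\<Union>s\<in>F. ball s (d s))"
    by (rule compactE_image[where f = "\<lambda>s. ball s (d s)"]) (use dc(1) in auto)
  show thesis
  proof
    fix s assume "\<bar>s\<bar> \<le> S"
    then have "s \<in> {- S..S}" by auto
    then obtain u where u: "u \<in> F" "\<bar>s - u\<bar> < d u"
      using F(3) by (auto simp: dist_real_def abs_minus_commute)
    then have "h s \<le> c u"
      using dc(2) by blast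
    also have "\<dots> \<le> (\<Sum>u\<in>F. \<bar>c u\<bar>)"
      using member_le_sum[OF u(1), of "\<lambda>u. \<bar>c u\<bar>"] F(2) by (smt (verit) abs_ge_zero)
    finally show "h s \<le> (\<Sum>u\<in>F. \<bar>c u\<bar>)" .
  qed
qed

section \<open>From resolvent growth to decay\<close>

context bounded_semigroup_off_axis
begin

text \<open>
  A perturbation argument: \<open>\<i>s' + A\<close> differs from \<open>\<i>s + A\<close> by the bounded operator \<open>\<i>(s' - s)\<close>, whose
  contribution can be absorbed once \<open>\<bar>s' - s\<bar>\<close> is small compared with the reciprocal of the resolvent norm at \<open>s\<close>.
\<close>

lemma onorm_res_locally_bounded: "\<exists>d>0. \<exists>c. \<forall>s'. \<bar>s' - s\<bar> < d \<longrightarrow> onorm (res s') \<le> c"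
proof -
  define c where "c = onorm (res s) + 1"
  have c: "c \<ge> 1"
    using onorm_res_nonneg[of s] by (simp add: c_def)
  have "onorm (res s') \<le> 2 * c" if s': "\<bar>s' - s\<bar> < 1 / (2 * c)" for s'
  proof (rule onorm_bound)
    fix w
    let ?v = "res s' w"
    have "(\<i> * complex_of_real s) *\<^sub>C ?v + A ?v = w - (\<i> * complex_of_real (s' - s)) *\<^sub>C ?v"
      using res_right[of s' w] by (simp add: algebra_simps scaleC_diff_left)
    then have "norm ?v = norm (res s (w - (\<i> * complex_of_real (s' - s)) *\<^sub>C ?v))"
      using res_left[OF res_in_domain[of s' w], of s] by simp
    also have "\<dots> \<le> c * norm (w - (\<i> * complex_of_real (s' - s)) *\<^sub>C ?v)"
      using norm_res[of s "w - (\<i> * complex_of_real (s' - s)) *\<^sub>C ?v"]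
      unfolding c_def distrib_right by (rule add_increasing2[rotated]) simp
    also have "\<dots> \<le> c * (norm w + \<bar>s' - s\<bar> * norm ?v)"
      using c norm_triangle_ineq4[of w "(\<i> * complex_of_real (s' - s)) *\<^sub>C ?v"]
      by (intro mult_left_mono) (auto simp: norm_scaleC norm_mult simp flip: of_real_diff)
    also have "\<dots> = c * norm w + (c * \<bar>s' - s\<bar>) * norm ?v"
      by (simp add: algebra_simps)
    also have "\<dots> \<le> c * norm w + 1 / 2 * norm ?v"
      using s' c by (intro add_left_mono mult_right_mono) (auto simp: field_simps)
    finally show "norm ?v \<le> 2 * c * norm w" by simp
  qed (use c in simp)
  then show ?thesis
    using c by (intro exI[of _ "1 / (2 * c)"]) auto
qed

text \<open>
  The shift by 2 keeps the logarithm away from 0, so that the growth rate, given only near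
  infinity, makes sense as a bound for all frequencies.
\<close>

lemma onorm_res_global_bound:
  assumes \<alpha>: "\<alpha> > 0"
    and O: "(\<lambda>s. onorm (res s)) \<in> O[at_infinity](\<lambda>s. \<bar>s\<bar> powr \<alpha> * ln \<bar>s\<bar> powr \<gamma>)"
  obtains C where "C > 0" "\<And>s. onorm (res s) \<le> C * powr_ln \<alpha> \<gamma> (2 + \<bar>s\<bar>)"
    "\<And>s. 1 \<le> C * powr_ln \<alpha> \<gamma> (2 + \<bar>s\<bar>)"
proof -
  obtain Q where Q: "Q > 0" "\<And>x y. 2 \<le> x \<Longrightarrow> x \<le> y \<Longrightarrow> powr_ln \<alpha> \<gamma> x \<le> Q * powr_ln \<alpha> \<gamma> y"
    using powr_ln_le[OF \<alpha>] by metis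
  obtain c where c: "c > 0"
    and ev: "\<forall>\<^sub>F s in at_infinity. norm (onorm (res s)) \<le> c * norm (\<bar>s\<bar> powr \<alpha> * ln \<bar>s\<bar> powr \<gamma>)"
    using landau_o.bigE[OF O] by blast
  obtain S where S: "\<And>s. S \<le> \<bar>s\<bar> \<Longrightarrow> norm (onorm (res s)) \<le> c * norm (\<bar>s\<bar> powr \<alpha> * ln \<bar>s\<bar> powr \<gamma>)"
    using ev by (auto simp: eventually_at_infinity)
  obtain B where B: "\<And>s. \<bar>s\<bar> \<le> max 2 S \<Longrightarrow> onorm (res s) \<le> B"
    using locally_bounded_imp_bounded[of "\<lambda>s. onorm (res s)"] onorm_res_locally_bounded by metis
  have q2: "powr_ln \<alpha> \<gamma> 2 > 0"
    by (rule powr_ln_pos) simp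
  define C where "C = c * Q + (\<bar>B\<bar> + 1) * Q / powr_ln \<alpha> \<gamma> 2"
  define P where "P = (\<lambda>s. (\<bar>B\<bar> + 1) * (Q * powr_ln \<alpha> \<gamma> (2 + \<bar>s\<bar>) / powr_ln \<alpha> \<gamma> 2))"
  have const: "\<bar>B\<bar> + 1 \<le> P s" for s
    using mult_left_mono[of 1 "Q * powr_ln \<alpha> \<gamma> (2 + \<bar>s\<bar>) / powr_ln \<alpha> \<gamma> 2" "\<bar>B\<bar> + 1"]
      Q(2)[of 2 "2 + \<bar>s\<bar>"] q2 by (simp add: P_def)
  have split: "C * powr_ln \<alpha> \<gamma> (2 + \<bar>s\<bar>) = c * (Q * powr_ln \<alpha> \<gamma> (2 + \<bar>s\<bar>)) + P s" for s
    by (simp add: C_def P_def algebra_simps)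
  have pos: "0 \<le> c * (Q * powr_ln \<alpha> \<gamma> (2 + \<bar>s\<bar>))" for s
    using c Q powr_ln_pos[of "2 + \<bar>s\<bar>" \<alpha> \<gamma>] by simp
  show thesis
  proof
    show "C > 0"
      using c Q(1) q2 by (simp add: C_def add_pos_pos)
    show "1 \<le> C * powr_ln \<alpha> \<gamma> (2 + \<bar>s\<bar>)" for s
      using const[of s] pos[of s] split[of s] by linarith
    show "onorm (res s) \<le> C * powr_ln \<alpha> \<gamma> (2 + \<bar>s\<bar>)" for s
    proof (cases "\<bar>s\<bar> \<le> max 2 S")
      case True
      then show ?thesis
        using B[of s] const[of s] pos[of s] split[of s] by linarith
    next
      case False
      then have "onorm (res s) \<le> c * powr_ln \<alpha> \<gamma> \<bar>s\<bar>"
        using S[of s] onorm_res_nonneg[of s] by (simp add: powr_ln_def abs_mult)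
      also have "\<dots> \<le> c * (Q * powr_ln \<alpha> \<gamma> (2 + \<bar>s\<bar>))"
        using c False by (intro mult_left_mono Q) auto
      finally show ?thesis
        using const[of s] split[of s] by linarith
    qed
  qed
qed

text \<open>
  Put \<open>M(s) = s\<^sup>\<alpha> (ln s)\<^sup>\<gamma>\<close>. For \<open>n > 1/\<alpha>\<close> the function \<open>M\<^sup>n / s\<close> is again a positive power with a
  logarithmic factor, hence dominated on all frequencies by its value at \<open>R\<close>, up to the loss at
  large \<open>\<bar>s\<bar>\<close> that the Gaussian pays for. The decay estimate then reads \<open>\<parallel>T(t) A\<inverse>\<parallel> = O(((M(R)/t)\<^sup>n + 1)/R)\<close>,
  and \<open>R = t\<^sup>1\<^sup>/\<^sup>\<alpha> (ln t)\<^sup>-\<^sup>\<gamma>\<^sup>/\<^sup>\<alpha>\<close> makes \<open>M(R)\<close> comparable to \<open>t\<close>.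
\<close>

theorem resolvent_growth_imp_decay:
  assumes \<alpha>: "\<alpha> > 0"
    and O: "(\<lambda>s. onorm (res s)) \<in> O[at_infinity](\<lambda>s. \<bar>s\<bar> powr \<alpha> * ln \<bar>s\<bar> powr \<gamma>)"
  shows "(\<lambda>t. onorm (T t \<circ> res 0)) \<in> O[at_top](\<lambda>t. t powr (- 1 / \<alpha>) * ln t powr (\<gamma> / \<alpha>))"
proof -
  obtain C where C: "C > 0" "\<And>s. onorm (res s) \<le> C * powr_ln \<alpha> \<gamma> (2 + \<bar>s\<bar>)"
      "\<And>s. 1 \<le> C * powr_ln \<alpha> \<gamma> (2 + \<bar>s\<bar>)"
    using onorm_res_global_bound[OF \<alpha> O] by metis
  obtain n :: nat where n: "real n > 1 / \<alpha>"
    using reals_Archimedean2 by blast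
  define \<delta> where "\<delta> = n * \<alpha> - 1"
  have \<delta>: "\<delta> > 0"
    using n \<alpha> by (simp add: \<delta>_def field_simps)
  have n1: "n \<ge> 1"
    using n \<alpha> by (cases n) (auto simp: field_simps)
  have power_n: "powr_ln \<alpha> \<gamma> x ^ n = x * powr_ln \<delta> (n * \<gamma>) x" if "x \<ge> 2" for x
  proof -
    have "powr_ln \<alpha> \<gamma> x ^ n = x powr (n * \<alpha>) * ln x powr (n * \<gamma>)"
      using that by (simp add: powr_ln_def power_mult_distrib powr_powr mult.commute flip: powr_realpow)
    also have "x powr (n * \<alpha>) = x * x powr \<delta>"
      using that by (simp add: \<delta>_def powr_diff)
    finally show ?thesis
      by (simp add: powr_ln_def)
  qed
  obtain Q where Q: "Q > 0" "\<And>x y. 2 \<le> x \<Longrightarrow> 2 \<le> y \<Longrightarrow>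
      powr_ln \<delta> (n * \<gamma>) x \<le> Q * powr_ln \<delta> (n * \<gamma>) y * (1 + x / y) powr (2 * \<delta>)"
    using powr_ln_le[OF \<delta>] by metis
  define E where "E = exp (2 * \<delta> + 2 * (2 * \<delta>)\<^sup>2)"
  obtain C' where C': "C' \<ge> 0"
    "\<And>R N \<kappa>. R \<ge> 1 \<Longrightarrow> N \<ge> 2 \<Longrightarrow>
        (\<And>s. (C * powr_ln \<alpha> \<gamma> (2 + \<bar>s\<bar>)) ^ n / (1 + \<bar>s\<bar>) * exp (- (s / R)\<^sup>2 / 8) \<le> \<kappa>)
      \<Longrightarrow> onorm (T N \<circ> res 0) \<le> C' * (\<kappa> / N ^ n + 1 / R)"
    using decay_estimate[OF n1, of "\<lambda>s. C * powr_ln \<alpha> \<gamma> (2 + \<bar>s\<bar>)"] C(2,3) by metis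
  define C2 where "C2 = 2 * C ^ n * Q * E"
  have C2: "C2 \<ge> 0"
    using C(1) Q(1) by (simp add: C2_def E_def)
  have decay: "onorm (T N \<circ> res 0) \<le> C' * (C2 * powr_ln \<delta> (n * \<gamma>) (2 + R) / N ^ n + 1 / R)"
    if R: "R \<ge> 1" and N: "N \<ge> 2" for R N
  proof (rule C'(2)[OF R N])
    fix s :: real
    define x where "x = 2 + \<bar>s\<bar>"
    define z where "z = \<bar>s\<bar> / R"
    have x: "x \<ge> 2"
      by (simp add: x_def)
    have z: "z \<ge> 0" "(s / R)\<^sup>2 = z\<^sup>2"
      using R by (auto simp: z_def power_divide)
    have ratio: "1 + x / (2 + R) \<le> 2 + z"
      using R by (simp add: x_def z_def field_simps)
    have P: "powr_ln \<delta> (n * \<gamma>) (2 + R) > 0"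
      using R by (intro powr_ln_pos) auto
    have "(C * powr_ln \<alpha> \<gamma> x) ^ n / (1 + \<bar>s\<bar>) = C ^ n * powr_ln \<delta> (n * \<gamma>) x * (x / (1 + \<bar>s\<bar>))"
      using x by (simp add: power_mult_distrib power_n)
    also have "\<dots> \<le> C ^ n * powr_ln \<delta> (n * \<gamma>) x * 2"
      using C(1) powr_ln_pos[OF x] by (intro mult_left_mono) (auto simp: x_def field_simps less_imp_le)
    also have "\<dots> \<le> C ^ n * (Q * powr_ln \<delta> (n * \<gamma>) (2 + R) * (2 + z) powr (2 * \<delta>)) * 2"
    proof -
      have "powr_ln \<delta> (n * \<gamma>) x \<le> Q * powr_ln \<delta> (n * \<gamma>) (2 + R) * (1 + x / (2 + R)) powr (2 * \<delta>)"
        using x R by (intro Q) auto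
      also have "\<dots> \<le> Q * powr_ln \<delta> (n * \<gamma>) (2 + R) * (2 + z) powr (2 * \<delta>)"
        using ratio x R \<delta> Q(1) P by (intro mult_left_mono powr_mono2) auto
      finally show ?thesis
        using C(1) by (intro mult_right_mono mult_left_mono) auto
    qed
    finally have "(C * powr_ln \<alpha> \<gamma> x) ^ n / (1 + \<bar>s\<bar>) * exp (- (s / R)\<^sup>2 / 8)
        \<le> C ^ n * (Q * powr_ln \<delta> (n * \<gamma>) (2 + R) * (2 + z) powr (2 * \<delta>)) * 2 * exp (- z\<^sup>2 / 8)"
      unfolding z(2) by (intro mult_right_mono) auto
    also have "\<dots> = 2 * C ^ n * Q * powr_ln \<delta> (n * \<gamma>) (2 + R) * ((2 + z) powr (2 * \<delta>) * exp (- z\<^sup>2 / 8))"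
      by (simp only: mult_ac)
    also have "\<dots> \<le> 2 * C ^ n * Q * powr_ln \<delta> (n * \<gamma>) (2 + R) * E"
      unfolding E_def using C(1) Q(1) P \<delta> z by (intro mult_left_mono powr_le_gaussian) auto
    finally show "(C * powr_ln \<alpha> \<gamma> (2 + \<bar>s\<bar>)) ^ n / (1 + \<bar>s\<bar>) * exp (- (s / R)\<^sup>2 / 8)
        \<le> C2 * powr_ln \<delta> (n * \<gamma>) (2 + R)"
      by (simp add: x_def C2_def mult_ac)
  qed
  \<comment> \<open>This is the value of \<open>2 + R\<close>: the bound on the resolvent is a function of \<open>2 + \<bar>s\<bar>\<close>.\<close>
  define \<rho> where "\<rho> = (\<lambda>t::real. t powr (1 / \<alpha>) * ln t powr (- \<gamma> / \<alpha>))"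
  have \<rho>_top: "filterlim \<rho> at_top at_top"
    unfolding \<rho>_def using \<alpha> by real_asymp
  have "((\<lambda>t. (ln (\<rho> t) / ln t) powr \<gamma>) \<longlongrightarrow> (1 / \<alpha>) powr \<gamma>) at_top"
  proof (rule tendsto_powr)
    show "((\<lambda>t. ln (\<rho> t) / ln t) \<longlongrightarrow> 1 / \<alpha>) at_top"
      unfolding \<rho>_def using \<alpha> by real_asymp
  qed (use \<alpha> in auto)
  then have ev1: "\<forall>\<^sub>F t in at_top. (ln (\<rho> t) / ln t) powr \<gamma> < (1 / \<alpha>) powr \<gamma> + 1"
    by (rule order_tendstoD) simp
  have ev2: "\<forall>\<^sub>F t in at_top. \<rho> t \<ge> 3"
    using \<rho>_top by (simp add: filterlim_at_top)
  define M where "M = (1 / \<alpha>) powr \<gamma> + 1"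
  have "\<forall>\<^sub>F t in at_top. norm (onorm (T t \<circ> res 0))
      \<le> C' * (C2 * M ^ n + 3) * norm (t powr (- 1 / \<alpha>) * ln t powr (\<gamma> / \<alpha>))"
    using ev1 ev2 eventually_ge_at_top[of 2]
  proof eventually_elim
    case (elim t)
    have lt: "ln t > 0"
      using elim by simp
    have "powr_ln \<alpha> \<gamma> (\<rho> t) = t * (ln (\<rho> t) / ln t) powr \<gamma>"
    proof -
      have "\<rho> t powr \<alpha> = t * ln t powr (- \<gamma>)"
        using elim \<alpha> by (simp add: \<rho>_def powr_mult powr_powr)
      then show ?thesis
        using elim lt by (simp add: powr_ln_def powr_divide powr_minus field_simps)
    qed
    then have q: "powr_ln \<alpha> \<gamma> (\<rho> t) \<le> t * M"
      using elim by (simp add: M_def less_imp_le)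
    have "powr_ln \<delta> (n * \<gamma>) (\<rho> t) / t ^ n = powr_ln \<alpha> \<gamma> (\<rho> t) ^ n / (\<rho> t * t ^ n)"
      using elim by (simp add: power_n)
    also have "\<dots> \<le> (t * M) ^ n / (\<rho> t * t ^ n)"
      using elim q powr_ln_pos[of "\<rho> t" \<alpha> \<gamma>] by (intro divide_right_mono power_mono) auto
    also have "\<dots> = M ^ n / \<rho> t"
      using elim by (simp add: power_mult_distrib)
    finally have 1: "powr_ln \<delta> (n * \<gamma>) (\<rho> t) / t ^ n \<le> M ^ n / \<rho> t" .
    have 2: "1 / (\<rho> t - 2) \<le> 3 / \<rho> t"
      using elim by (simp add: field_simps)
    have "onorm (T t \<circ> res 0) \<le> C' * (C2 * powr_ln \<delta> (n * \<gamma>) (2 + (\<rho> t - 2)) / t ^ n + 1 / (\<rho> t - 2))"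
      using elim by (intro decay) auto
    also have "\<dots> = C' * (C2 * (powr_ln \<delta> (n * \<gamma>) (\<rho> t) / t ^ n) + 1 / (\<rho> t - 2))"
      by simp
    also have "\<dots> \<le> C' * (C2 * (M ^ n / \<rho> t) + 3 / \<rho> t)"
      using 1 2 C'(1) C2 by (intro mult_left_mono add_mono) auto
    also have "\<dots> = C' * (C2 * M ^ n + 3) * (1 / \<rho> t)"
      by (simp add: algebra_simps add_divide_distrib)
    also have "1 / \<rho> t = t powr (- 1 / \<alpha>) * ln t powr (\<gamma> / \<alpha>)"
      using elim lt by (simp add: \<rho>_def powr_minus field_simps)
    finally show ?case
      using onorm_pos_le[OF bounded_linear_compose[OF T_bounded_linear res_bounded_linear], of t 0] elim
      by (simp add: o_def)
  qed
  then show ?thesis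
    by (rule bigoI)
qed

end

section \<open>From decay to resolvent growth\<close>

context bounded_semigroup_off_axis
begin

text \<open>
  For \<open>z = R\<^sub>s w\<close> one has \<open>A z = w - \<i>s z\<close>, so \<open>\<parallel>T(t)z\<parallel> \<le> \<parallel>T(t) A\<inverse>\<parallel> (\<parallel>w\<parallel> + \<bar>s\<bar> \<parallel>z\<parallel>)\<close>. If \<open>t\<close> is so large that
  \<open>\<parallel>T(t) A\<inverse>\<parallel> \<bar>s\<bar> \<le> 1/2\<close>, the term with \<open>z\<close> can be absorbed in \<open>norm_le_orbit\<close>, which leaves a bound of
  order \<open>t\<close> for the resolvent. A large multiple of \<open>\<bar>s\<bar>\<^sup>\<alpha> (ln \<bar>s\<bar>)\<^sup>-\<^sup>\<beta>\<close> is such a \<open>t\<close>.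
\<close>

theorem decay_imp_resolvent_growth:
  assumes \<alpha>: "\<alpha> > 0" and \<beta>: "\<beta> \<ge> 0"
    and O: "(\<lambda>t. onorm (T t \<circ> res 0)) \<in> O[at_top](\<lambda>t. t powr (- 1 / \<alpha>) * ln t powr (- \<beta> / \<alpha>))"
  shows "(\<lambda>s. onorm (res s)) \<in> O[at_infinity](\<lambda>s. \<bar>s\<bar> powr \<alpha> * ln \<bar>s\<bar> powr (- \<beta>))"
proof -
  obtain c where c: "c > 0" and ev:
    "\<forall>\<^sub>F t in at_top. norm (onorm (T t \<circ> res 0)) \<le> c * norm (t powr (- 1 / \<alpha>) * ln t powr (- \<beta> / \<alpha>))"
    using landau_o.bigE[OF O] by blast
  \<comment> \<open>The multiple for which the estimate of \<open>\<parallel>T(t) A\<inverse>\<parallel> \<bar>s\<bar>\<close> below comes out as exactly 1/2;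
    \<open>\<alpha>/2\<close> is a lower bound for \<open>ln t / ln \<bar>s\<bar>\<close>, which tends to \<open>\<alpha>\<close>.\<close>
  define B where "B = (2 * c * (\<alpha> / 2) powr (- \<beta> / \<alpha>)) powr \<alpha>"
  have B: "B > 0"
    using c \<alpha> by (simp add: B_def)
  have Broot: "c * B powr (- 1 / \<alpha>) * (\<alpha> / 2) powr (- \<beta> / \<alpha>) = 1 / 2"
  proof -
    have "B powr (- 1 / \<alpha>) = 1 / (2 * c * (\<alpha> / 2) powr (- \<beta> / \<alpha>))"
      using c \<alpha> by (simp add: B_def powr_powr powr_minus_divide)
    then show ?thesis
      using c \<alpha> by simp
  qed
  define \<tau> where "\<tau> = (\<lambda>u::real. B * u powr \<alpha> * ln u powr (- \<beta>))"
  have \<tau>_top: "filterlim \<tau> at_top at_top"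
    unfolding \<tau>_def using \<alpha> B by real_asymp
  have "((\<lambda>u. ln (\<tau> u) / ln u) \<longlongrightarrow> \<alpha>) at_top"
    unfolding \<tau>_def using \<alpha> B by real_asymp
  then have ev1: "\<forall>\<^sub>F u in at_top. \<alpha> / 2 < ln (\<tau> u) / ln u"
    by (rule order_tendstoD) (use \<alpha> in simp)
  have ev2: "\<forall>\<^sub>F u in at_top. norm (onorm (T (\<tau> u) \<circ> res 0))
      \<le> c * norm (\<tau> u powr (- 1 / \<alpha>) * ln (\<tau> u) powr (- \<beta> / \<alpha>))"
    using ev \<tau>_top by (rule eventually_compose_filterlim)
  have ev3: "\<forall>\<^sub>F u in at_top. \<tau> u \<ge> 1"
    using \<tau>_top by (simp add: filterlim_at_top)
  have main: "\<forall>\<^sub>F u in at_top. \<tau> u \<ge> 1 \<and> u \<ge> 2 \<and> onorm (T (\<tau> u) \<circ> res 0) * u \<le> 1 / 2"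
    using ev1 ev2 ev3 eventually_ge_at_top[of 2]
  proof eventually_elim
    case (elim u)
    have lu: "ln u > 0"
      using elim by simp
    have "\<tau> u powr (- 1 / \<alpha>) = B powr (- 1 / \<alpha>) * (u powr \<alpha>) powr (- 1 / \<alpha>) * (ln u powr (- \<beta>)) powr (- 1 / \<alpha>)"
      using B by (simp add: \<tau>_def powr_mult)
    moreover have "(u powr \<alpha>) powr (- 1 / \<alpha>) = 1 / u"
      using elim(4) \<alpha> by (simp add: powr_powr powr_minus_divide)
    moreover have "(ln u powr (- \<beta>)) powr (- 1 / \<alpha>) = ln u powr (\<beta> / \<alpha>)"
      by (simp add: powr_powr)
    ultimately have root: "\<tau> u powr (- 1 / \<alpha>) = B powr (- 1 / \<alpha>) * (1 / u) * ln u powr (\<beta> / \<alpha>)"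
      by simp
    have log: "ln (\<tau> u) powr (- \<beta> / \<alpha>) \<le> (\<alpha> / 2 * ln u) powr (- \<beta> / \<alpha>)"
      using elim lu \<alpha> \<beta> by (intro powr_mono2') (auto simp: field_simps)
    have "c * (\<tau> u powr (- 1 / \<alpha>) * ln (\<tau> u) powr (- \<beta> / \<alpha>))
        \<le> c * (B powr (- 1 / \<alpha>) * (1 / u) * ln u powr (\<beta> / \<alpha>) * (\<alpha> / 2 * ln u) powr (- \<beta> / \<alpha>))"
      unfolding root using c elim by (intro mult_left_mono log) auto
    also have "\<dots> = (c * B powr (- 1 / \<alpha>) * (\<alpha> / 2) powr (- \<beta> / \<alpha>)) * (1 / u) * (ln u powr (\<beta> / \<alpha>) * ln u powr (- \<beta> / \<alpha>))"
    proof -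
      have split: "(\<alpha> / 2 * ln u) powr (- \<beta> / \<alpha>) = (\<alpha> / 2) powr (- \<beta> / \<alpha>) * ln u powr (- \<beta> / \<alpha>)"
        using lu \<alpha> by (subst powr_mult) auto
      show ?thesis
        unfolding split by (simp only: mult_ac)
    qed
    also have "ln u powr (\<beta> / \<alpha>) * ln u powr (- \<beta> / \<alpha>) = 1"
      using lu by (simp flip: powr_add)
    also note Broot
    finally have "onorm (T (\<tau> u) \<circ> res 0) \<le> 1 / 2 * (1 / u)"
      using elim(2) by (simp add: abs_mult)
    then show ?case
      using elim by (simp add: field_simps)
  qed
  have est: "onorm (res s) \<le> 3 * K * \<tau> \<bar>s\<bar>"
    if s: "\<tau> \<bar>s\<bar> \<ge> 1" "\<bar>s\<bar> \<ge> 2" "onorm (T (\<tau> \<bar>s\<bar>) \<circ> res 0) * \<bar>s\<bar> \<le> 1 / 2" for s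
  proof (rule onorm_bound)
    show "0 \<le> 3 * K * \<tau> \<bar>s\<bar>"
      using s K by simp
    fix w
    define t where "t = \<tau> \<bar>s\<bar>"
    define m where "m = onorm (T t \<circ> res 0)"
    define v where "v = res s w"
    have lin: "bounded_linear (T t \<circ> res 0)"
      using bounded_linear_compose[OF T_bounded_linear res_bounded_linear, of t 0] s by (simp add: o_def t_def)
    have m: "m \<ge> 0" "m * \<bar>s\<bar> \<le> 1 / 2" "m \<le> 1 / 2"
    proof -
      show "m \<ge> 0"
        unfolding m_def by (rule onorm_pos_le[OF lin])
      show *: "m * \<bar>s\<bar> \<le> 1 / 2"
        using s by (simp add: m_def t_def)
      show "m \<le> 1 / 2"
        using * \<open>m \<ge> 0\<close> s mult_left_mono[of 1 "\<bar>s\<bar>" m] by simp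
    qed
    have Av: "A v = w - (\<i> * complex_of_real s) *\<^sub>C v"
      using res_right[of s w] by (simp add: v_def algebra_simps)
    have "norm (A v) \<le> norm w + norm ((\<i> * complex_of_real s) *\<^sub>C v)"
      unfolding Av by (rule norm_triangle_ineq4)
    then have nAv: "norm (A v) \<le> norm w + \<bar>s\<bar> * norm v"
      by (simp add: norm_scaleC norm_mult)
    have "v = res 0 (A v)"
      using res_left[of v 0] res_in_domain[of s w] by (simp add: v_def)
    then have "norm (T t v) \<le> m * norm (A v)"
      using onorm[OF lin, of "A v"] by (simp add: m_def)
    also have "\<dots> \<le> m * (norm w + \<bar>s\<bar> * norm v)"
      using m nAv by (intro mult_left_mono)
    also have "\<dots> = m * norm w + (m * \<bar>s\<bar>) * norm v"
      by (simp add: algebra_simps)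
    also have "\<dots> \<le> 1 / 2 * norm w + 1 / 2 * norm v"
      using m by (intro add_mono mult_right_mono) auto
    finally have "norm v \<le> 1 / 2 * norm w + 1 / 2 * norm v + t * K * norm w"
      using norm_le_orbit[of t v s] s res_in_domain[of s w] res_right[of s w] by (simp add: t_def v_def)
    moreover have "1 * norm w \<le> t * K * norm w"
      using s K mult_mono[of 1 t 1 K] by (intro mult_right_mono) (auto simp: t_def)
    ultimately have "norm v \<le> 3 * (t * K * norm w)"
      by linarith
    then show "norm (res s w) \<le> 3 * K * \<tau> \<bar>s\<bar> * norm w"
      by (simp add: v_def t_def mult_ac)
  qed
  have "filterlim (\<lambda>s::real. \<bar>s\<bar>) at_top at_infinity"
    using filterlim_norm_at_top[where 'a = real] by (simp add: real_norm_def[abs_def])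
  from eventually_compose_filterlim[OF main this]
  have "\<forall>\<^sub>F s in at_infinity. norm (onorm (res s)) \<le> 3 * K * B * norm (\<bar>s\<bar> powr \<alpha> * ln \<bar>s\<bar> powr (- \<beta>))"
  proof eventually_elim
    case (elim s)
    then show ?case
      using est[of s] onorm_res_nonneg[of s] by (simp add: \<tau>_def abs_mult mult_ac)
  qed
  then show ?thesis
    by (rule bigoI)
qed

end

section \<open>Fine scales of decay\<close>

theorem theorem1p3:
  fixes T :: "real \<Rightarrow> 'a::chilbert_space \<Rightarrow> 'a"
    and D :: "'a set"
    and A :: "'a \<Rightarrow> 'a"
    and \<alpha> \<beta> :: real
  assumes "bounded_C0_semigroup T"
    and "is_generator T D (\<lambda>x. - A x)"
    and "spectrum D A \<inter> {z. Re z = 0} = {}"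
    and "\<alpha> > 0" and "\<beta> \<ge> 0"
  shows
    "((\<lambda>s::real. onorm (inv_into D (\<lambda>x. (\<i> * complex_of_real s) *\<^sub>C x + A x)))
          \<in> O[at_infinity](\<lambda>s. \<bar>s\<bar> powr \<alpha> * ln \<bar>s\<bar> powr (- \<beta>))
        \<longleftrightarrow>
      (\<lambda>t::real. onorm (T t \<circ> inv_into D A))
          \<in> O[at_top](\<lambda>t. t powr (- 1 / \<alpha>) * ln t powr (- \<beta> / \<alpha>)))
     \<and>
     ((\<lambda>s::real. onorm (inv_into D (\<lambda>x. (\<i> * complex_of_real s) *\<^sub>C x + A x)))
          \<in> O[at_infinity](\<lambda>s. \<bar>s\<bar> powr \<alpha> * ln \<bar>s\<bar> powr \<beta>)
        \<longrightarrow>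
      (\<forall>\<epsilon>>0. (\<lambda>t::real. onorm (T t \<circ> inv_into D A))
          \<in> O[at_top](\<lambda>t. t powr (- 1 / \<alpha>) * ln t powr (\<epsilon> + \<beta> / \<alpha>))))"
proof -
  obtain M where C0: "C0_semigroup T" and M: "\<And>t. t \<ge> 0 \<Longrightarrow> onorm (T t) \<le> M"
    using assms(1) by (auto simp: bounded_C0_semigroup_def)
  interpret bounded_semigroup_off_axis T D A "max 1 M"
  proof
    fix t :: real and x assume t: "t \<ge> 0"
    then have "norm (T t x) \<le> onorm (T t) * norm x"
      using C0 by (intro onorm) (auto simp: C0_semigroup_def bounded_clinear_def)
    also have "\<dots> \<le> max 1 M * norm x"
      using M[OF t] by (intro mult_right_mono) auto
    finally show "norm (T t x) \<le> max 1 M * norm x" .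
  qed (use C0 assms in auto)
  have weaken: "(\<lambda>t. t powr (- 1 / \<alpha>) * ln t powr (\<beta> / \<alpha>))
      \<in> O[at_top](\<lambda>t. t powr (- 1 / \<alpha>) * ln t powr (\<epsilon> + \<beta> / \<alpha>))" if "\<epsilon> > 0" for \<epsilon>
  proof (rule bigoI)
    show "\<forall>\<^sub>F t in at_top. norm (t powr (- 1 / \<alpha>) * ln t powr (\<beta> / \<alpha>))
        \<le> 1 * norm (t powr (- 1 / \<alpha>) * ln t powr (\<epsilon> + \<beta> / \<alpha>))"
      using eventually_ge_at_top[of "exp 1"]
    proof eventually_elim
      case (elim t)
      then have "ln t \<ge> 1"
        by (metis exp_gt_zero ln_exp ln_le_cancel_iff order_less_le_trans)
      then show ?case
        using that by (simp add: abs_mult mult_left_mono powr_mono)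
    qed
  qed
  show ?thesis
    unfolding res_def[symmetric] res_0[symmetric]
    using resolvent_growth_imp_decay[OF assms(4)] decay_imp_resolvent_growth[OF assms(4,5)]
      landau_o.big_trans[OF resolvent_growth_imp_decay[OF assms(4), of \<beta>] weaken]
    by blast
qed

end
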